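(* Let $G$ be a broadcasting with side information problem with message set $V=[n]$ and $m$ receivers, and for $k=1,\dots,n$ let $b_k$ be the optimal value of the linear program $\mathcal{B}_k$ defined below. Then: (a) each $\mathcal{B}_k$ is a relaxation of $\mathcal{B}_{k+1}$, so $b_1\le b_2\le\cdots\le b_n$; (b) the broadcast rate satisfies $b_2\le \beta(G)\le b_n$; (c) both inequalities in (b) can be strict: there exist broadcasting with side information problems with $b_2<\beta$, and there exist broadcasting with side information problems with $\beta<b_n$; (d) when $G$ is a graph (undirected side-information graph), $b_1=\alpha(G)$, the independence number of $G$, and $b_n=\overline{\chi}_f(G)$, the fractional clique-cover number of $G$.
   Context: A broadcasting with side information problem: a server holds messages $x_1,\dots,x_n\in\Sigma$ ($|\Sigma|>1$); there are receivers $R_1,\dots,R_m$; receiver $R_j$ wants $x_{f(j)}$ and knows the messages indexed by a set $N(j)\subseteq[n]\setminus\{f(j)\}$. A solution is an encoding $\mathcal{E}:\Sigma^n\to\Sigma_P$ such that every $R_j$ can determine $x_{f(j)}$ from $\mathcal{E}(x_1,\dots,x_n)$ and $(x_i)_{i\in N(j)}$, for all possible message values. $\beta_t(G)$ is the minimum of $\lceil\log_2|\Sigma_P|\rceil$ over solutions with $|\Sigma|=2^t$, and the broadcast rate is $\beta(G)=\lim_{t\to\infty}\beta_t(G)/t=\inf_t\beta_t(G)/t$. "$G$ is a graph" means $m=n$, $f(j)=j$, and there is an undirected graph on $[n]$ such that $N(i)$ is the neighborhood of $i$. For $A,B\subseteq V$, write $A\rightsquigarrow B$ ("$A$ decodes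 $B$") if $A\subseteq B$ and for every $x\in B\setminus A$ there is a receiver $R_j$ with $f(j)=x$ and $N(j)\subseteq A$. The LP $\mathcal{B}_k$ has a variable $X(S)$ for each $S\subseteq V$ and is: minimize $X(\emptyset)$ subject to $X(V)\ge n$; $X(\emptyset)\ge0$; $X(S)+|T\setminus S|\ge X(T)$ for all $S\subseteq T\subseteq V$; $X(T)\ge X(S)$ for all $S\subseteq T\subseteq V$; $X(A)\ge X(B)$ whenever $A\rightsquigarrow B$; and $\sum_{T\subseteq R}(-1)^{|R\setminus T|}X(T\cup Z)\le 0$ for all $R\subseteq V$ with $2\le|R|\le k$ and all $Z\subseteq V$ with $Z\cap R=\emptyset$. The fractional clique-cover number $\overline{\chi}_f$ is the minimum total weight of a nonnegative weighting of the cliques of the graph such that every vertex lies in cliques of total weight at least $1$. *)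

theory Defs
  imports Complex_Main
begin

text \<open>A broadcasting with side information problem. Messages are indexed by
  V = {0..<nmsg} (0-based rendering of [n]); receivers by {0..<nrec}.
  Receiver j wants message (want j) and knows the messages in (know j).\<close>

record bsi =
  nmsg :: nat
  nrec :: nat
  want :: "nat \<Rightarrow> nat"
  know :: "nat \<Rightarrow> nat set"

definition Vset :: "bsi \<Rightarrow> nat set" where
  "Vset G = {0..<nmsg G}"

definition bsi_wf :: "bsi \<Rightarrow> bool" where
  "bsi_wf G \<longleftrightarrow> (\<forall>j<nrec G. want G j \<in> Vset G \<and> know G j \<subseteq> Vset G - {want G j})"

definition msgs :: "nat \<Rightarrow> nat \<Rightarrow> (nat \<Rightarrow> nat) set" where
  "msgs n t = {x. (\<forall>i<n. x i < 2 ^ t) \<and> (\<forall>i\<ge>n. x i = 0)}"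

definition restr :: "(nat \<Rightarrow> nat) \<Rightarrow> nat set \<Rightarrow> nat \<Rightarrow> nat" where
  "restr x A = (\<lambda>i. if i \<in> A then x i else 0)"

definition is_solution :: "bsi \<Rightarrow> nat \<Rightarrow> nat set \<Rightarrow> ((nat \<Rightarrow> nat) \<Rightarrow> nat) \<Rightarrow> bool" where
  "is_solution G t P E \<longleftrightarrow> finite P \<and> E ` msgs (nmsg G) t \<subseteq> P \<and>
     (\<forall>j<nrec G. \<exists>D :: nat \<Rightarrow> (nat \<Rightarrow> nat) \<Rightarrow> nat.
        \<forall>x\<in>msgs (nmsg G) t. D (E x) (restr x (know G j)) = x (want G j))"

definition beta_t :: "bsi \<Rightarrow> nat \<Rightarrow> nat" where
  "beta_t G t = Inf {nat \<lceil>log 2 (real (card P))\<rceil> | P E. is_solution G t P E}"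

definition broadcast_rate :: "bsi \<Rightarrow> real" where
  "broadcast_rate G = Inf ((\<lambda>t. real (beta_t G t) / real t) ` {1..})"

definition decodes :: "bsi \<Rightarrow> nat set \<Rightarrow> nat set \<Rightarrow> bool" where
  "decodes G A B \<longleftrightarrow> A \<subseteq> B \<and>
     (\<forall>x\<in>B - A. \<exists>j<nrec G. want G j = x \<and> know G j \<subseteq> A)"

definition lp_feasible :: "bsi \<Rightarrow> nat \<Rightarrow> (nat set \<Rightarrow> real) \<Rightarrow> bool" where
  "lp_feasible G k X \<longleftrightarrow>
     X (Vset G) \<ge> real (nmsg G) \<and>
     X {} \<ge> 0 \<and>
     (\<forall>S T. S \<subseteq> T \<and> T \<subseteq> Vset G \<longrightarrow> X S + real (card (T - S)) \<ge> X T) \<and>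
     (\<forall>S T. S \<subseteq> T \<and> T \<subseteq> Vset G \<longrightarrow> X T \<ge> X S) \<and>
     (\<forall>A B. A \<subseteq> Vset G \<and> B \<subseteq> Vset G \<and> decodes G A B \<longrightarrow> X A \<ge> X B) \<and>
     (\<forall>R Z. R \<subseteq> Vset G \<and> 2 \<le> card R \<and> card R \<le> k \<and> Z \<subseteq> Vset G \<and> Z \<inter> R = {} \<longrightarrow>
        (\<Sum>T\<in>Pow R. (-1::real) ^ card (R - T) * X (T \<union> Z)) \<le> 0)"

definition lp_value :: "bsi \<Rightarrow> nat \<Rightarrow> real" where
  "lp_value G k = Inf {X {} | X. lp_feasible G k X}"

definition is_graph :: "bsi \<Rightarrow> bool" where
  "is_graph G \<longleftrightarrow> nrec G = nmsg G \<and> (\<forall>j<nmsg G. want G j = j) \<and>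
     (\<forall>i\<in>Vset G. \<forall>j\<in>Vset G. j \<in> know G i \<longleftrightarrow> i \<in> know G j)"

definition independent_set :: "bsi \<Rightarrow> nat set \<Rightarrow> bool" where
  "independent_set G S \<longleftrightarrow> S \<subseteq> Vset G \<and> (\<forall>i\<in>S. \<forall>j\<in>S. j \<notin> know G i)"

definition independence_number :: "bsi \<Rightarrow> nat" where
  "independence_number G = Max {card S | S. independent_set G S}"

definition is_clique :: "bsi \<Rightarrow> nat set \<Rightarrow> bool" where
  "is_clique G C \<longleftrightarrow> C \<subseteq> Vset G \<and> (\<forall>i\<in>C. \<forall>j\<in>C. i \<noteq> j \<longrightarrow> j \<in> know G i)"

definition cliques :: "bsi \<Rightarrow> nat set set" where
  "cliques G = {C. is_clique G C}"

definition frac_clique_cover :: "bsi \<Rightarrow> (nat set \<Rightarrow> real) \<Rightarrow> bool" where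
  "frac_clique_cover G w \<longleftrightarrow> (\<forall>C\<in>cliques G. w C \<ge> 0) \<and>
     (\<forall>v\<in>Vset G. (\<Sum>C\<in>{C\<in>cliques G. v \<in> C}. w C) \<ge> 1)"

definition frac_clique_cover_number :: "bsi \<Rightarrow> real" where
  "frac_clique_cover_number G =
     Inf {(\<Sum>C\<in>cliques G. w C) | w. frac_clique_cover G w}"

end

theory Submission
  imports Defs "HOL-Library.FuncSet" "HOL-Number_Theory.Cong"
begin

text \<open>A code with uniform independent messages yields the feasible point
  \<open>X S = H(E, x\<^sub>S) / t\<close> of the second LP, by submodularity of entropy; this gives \<open>b\<^sub>2 \<le> \<beta>\<close>.

  Conversely, the constraints of the last LP say that \<open>X S - card S\<close> is a constant minus a nonnegative
  combination of the functions \<open>S \<mapsto> [C \<subseteq> S]\<close>, so that a feasible point is a fractional cover of the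
  receivers by sets \<open>C\<close>. The server broadcasts sums of the messages in \<open>C\<close> modulo pairwise coprime
  numbers slightly larger than \<open>2 ^ s\<close>; a receiver wanting \<open>v\<close> and knowing \<open>C - {v}\<close> learns a residue
  of \<open>x v\<close>, and enough residues determine \<open>x v\<close> by the Chinese remainder theorem. Hence \<open>\<beta> \<le> b\<^sub>n\<close>. For a
  graph the sets \<open>C\<close> can be shrunk to cliques.

  Strictness: for the directed triangle \<open>\<beta> \<le> 2 < 3 \<le> b\<^sub>3\<close>. For the Vamos matroid the rank function
  shows \<open>b\<^sub>2 \<le> 4\<close>, but the Zhang--Yeung inequality for entropies forces \<open>\<beta> \<ge> 45 / 11\<close>.\<close>

subsection \<open>Alternating sums and the linear programs\<close>

text \<open>The second LP expresses only Shannon-type properties of entropy, so submodularity alone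
  can never separate b_2 from the rate. What separates them is a polymatroid that no entropy
  function realizes, together with an inequality not implied by Shannon's; the Vamos rank and
  Zhang-Yeung are such a pair. The differences of order three and more in the later programs are not
  valid for entropies. They bound the rate from above because they confine a point to schemes in
  which each broadcast sum serves a receiver on its own; in the directed triangle a receiver does
  better by combining two sums. Different receivers use different families of sets \<open>C\<close>,
  so any sufficiently large family of residues must determine a message. Coprime moduli give this
  with plain integers, for an alphabet whose size is a power of two. Two errors have to vanish: the
  moduli exceed \<open>2 ^ s\<close> by a factor independent of \<open>s\<close>, and the real
  weights must be rounded to multiplicities.\<close>

definition alternating_sum :: "nat set \<Rightarrow> (nat set \<Rightarrow> real) \<Rightarrow> nat set \<Rightarrow> real" where
  "alternating_sum R X Z = (\<Sum>T\<in>Pow R. (-1) ^ card (R - T) * X (T \<union> Z))"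

lemma alternating_sum_empty [simp]: "alternating_sum {} X Z = X Z"
  by (simp add: alternating_sum_def)

text \<open>Subsets of \<open>insert x R\<close> split by whether they contain \<open>x\<close>.
  Thus \<open>alternating_sum R X Z\<close> is the iterated finite difference of \<open>X\<close> at
  \<open>Z\<close> in the directions \<open>R\<close>, and later arguments only use this
  recurrence.\<close>

lemma alternating_sum_insert:
  assumes "finite R" "x \<notin> R"
  shows "alternating_sum (insert x R) X Z = alternating_sum R X (insert x Z) - alternating_sum R X Z"
proof -
  have inj: "inj_on (insert x) (Pow R)"
    using assms(2) by (auto simp: inj_on_def)
  have disj: "Pow R \<inter> insert x ` Pow R = {}"
    using assms(2) by auto
  have 1: "(\<Sum>T\<in>Pow R. (-1) ^ card (insert x R - T) * X (T \<union> Z)) = - alternating_sum R X Z"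
    unfolding alternating_sum_def sum_negf [symmetric]
  proof (rule sum.cong)
    fix T assume T: "T \<in> Pow R"
    then have "insert x R - T = insert x (R - T)" using assms by auto
    then have "card (insert x R - T) = Suc (card (R - T))" using assms by auto
    then show "(-1) ^ card (insert x R - T) * X (T \<union> Z) = - ((-1) ^ card (R - T) * X (T \<union> Z))"
      by simp
  qed simp
  have 2: "(\<Sum>T\<in>Pow R. (-1) ^ card (insert x R - insert x T) * X (insert x T \<union> Z))
      = alternating_sum R X (insert x Z)"
    unfolding alternating_sum_def
  proof (rule sum.cong)
    fix T assume T: "T \<in> Pow R"
    have "insert x R - insert x T = R - T" using assms T by auto
    then show "(-1) ^ card (insert x R - insert x T) * X (insert x T \<union> Z)
       = (-1) ^ card (R - T) * X (T \<union> insert x Z)" by simp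
  qed simp
  show ?thesis
    unfolding alternating_sum_def [of "insert x R"] Pow_insert
    using assms 1 2 by (simp add: sum.union_disjoint disj sum.reindex [OF inj])
qed

lemma alternating_sum_linear:
  "alternating_sum R (\<lambda>S. a * X S + b * Y S) Z = a * alternating_sum R X Z + b * alternating_sum R Y Z"
  by (simp add: alternating_sum_def sum.distrib sum_distrib_left algebra_simps)

lemma alternating_sum_add:
  "alternating_sum R (\<lambda>S. X S + Y S) Z = alternating_sum R X Z + alternating_sum R Y Z"
  using alternating_sum_linear [of R 1 X 1 Y Z] by simp

lemma alternating_sum_diff:
  "alternating_sum R (\<lambda>S. X S - Y S) Z = alternating_sum R X Z - alternating_sum R Y Z"
  using alternating_sum_linear [of R 1 X "-1" Y Z] by simp

lemma alternating_sum_sum: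
  "alternating_sum R (\<lambda>S. \<Sum>i\<in>I. a i * X i S) Z = (\<Sum>i\<in>I. a i * alternating_sum R (X i) Z)"
  unfolding alternating_sum_def sum_distrib_left
  by (subst sum.swap) (simp add: mult_ac)

lemma alternating_sum_const:
  assumes "finite R" "R \<noteq> {}"
  shows "alternating_sum R (\<lambda>_. c) Z = 0"
proof -
  obtain x where x: "x \<in> R" using assms by auto
  have "alternating_sum (insert x (R - {x})) (\<lambda>_. c) Z = 0"
    by (subst alternating_sum_insert) (use assms in \<open>auto simp: alternating_sum_def\<close>)
  then show ?thesis using x by (simp add: insert_absorb)
qed

text \<open>One difference turns \<open>card\<close> into the constant 1 and any further one kills
  it. The constraints of order at least two therefore do not notice a shift by
  \<open>card\<close>.\<close>

lemma alternating_sum_card: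
  assumes "finite R" "finite Z" "R \<inter> Z = {}" "2 \<le> card R"
  shows "alternating_sum R (\<lambda>S. real (card S)) Z = 0"
proof -
  obtain x where x: "x \<in> R" using assms by fastforce
  define R' where "R' = R - {x}"
  have R: "R = insert x R'" "x \<notin> R'" "finite R'" "R' \<noteq> {}"
    using x assms by (auto simp: R'_def dest: card_mono [of "{x}", rotated])
  have "alternating_sum R' (\<lambda>S. real (card S)) (insert x Z)
      = alternating_sum R' (\<lambda>S. real (card S) + 1) Z"
    unfolding alternating_sum_def
  proof (rule sum.cong)
    fix T assume T: "T \<in> Pow R'"
    then have "finite (T \<union> Z)" "x \<notin> T \<union> Z"
      using assms R finite_subset by auto
    then show "(-1) ^ card (R' - T) * real (card (T \<union> insert x Z))
       = (-1) ^ card (R' - T) * (real (card (T \<union> Z)) + 1)"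
      by simp
  qed simp
  then show ?thesis
    using R by (simp add: alternating_sum_insert alternating_sum_add alternating_sum_const)
qed

lemma alternating_sum_pair:
  assumes "x \<noteq> y"
  shows "alternating_sum {x, y} X Z = X (insert x (insert y Z)) - X (insert x Z) - X (insert y Z) + X Z"
  using assms by (simp add: alternating_sum_insert insert_commute)

section \<open>Feasible points and values of the linear programs\<close>

lemma finite_Vset [simp]: "finite (Vset G)"
  by (simp add: Vset_def)

lemma card_Vset [simp]: "card (Vset G) = nmsg G"
  by (simp add: Vset_def)

lemma finite_subset_Vset: "S \<subseteq> Vset G \<Longrightarrow> finite S"
  using finite_subset finite_Vset by blast

lemma subset_insert_induct [consumes 2, case_names base step]:
  assumes "S \<subseteq> T" "finite T" "P S"
    and step: "\<And>U x. S \<subseteq> U \<Longrightarrow> U \<subseteq> T \<Longrightarrow> x \<in> T - U \<Longrightarrow> P U \<Longrightarrow> P (insert x U)"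
  shows "P T"
proof -
  have "P (S \<union> W)" if "finite W" "W \<subseteq> T - S" for W
    using that
  proof (induction W rule: finite_induct)
    case (insert x W)
    then show ?case using step [of "S \<union> W" x] assms(1) by auto
  qed (use assms in simp)
  from this [of "T - S"] show ?thesis
    using assms by (simp add: Un_absorb1 sup.absorb2)
qed

lemma lp_feasibleD:
  assumes "lp_feasible G k X"
  shows lp_feasible_V: "real (nmsg G) \<le> X (Vset G)"
    and lp_feasible_nonneg: "0 \<le> X {}"
    and lp_feasible_slope: "S \<subseteq> T \<Longrightarrow> T \<subseteq> Vset G \<Longrightarrow> X T \<le> X S + real (card (T - S))"
    and lp_feasible_mono: "S \<subseteq> T \<Longrightarrow> T \<subseteq> Vset G \<Longrightarrow> X S \<le> X T"
    and lp_feasible_decodes: "A \<subseteq> Vset G \<Longrightarrow> B \<subseteq> Vset G \<Longrightarrow> decodes G A B \<Longrightarrow> X B \<le> X A"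
    and lp_feasible_alternating: "R \<subseteq> Vset G \<Longrightarrow> 2 \<le> card R \<Longrightarrow> card R \<le> k \<Longrightarrow> Z \<subseteq> Vset G \<Longrightarrow>
        Z \<inter> R = {} \<Longrightarrow> alternating_sum R X Z \<le> 0"
  using assms unfolding lp_feasible_def alternating_sum_def by simp_all

lemma lp_feasible_receiver:
  assumes "lp_feasible G k X" "bsi_wf G" "j < nrec G" "know G j \<subseteq> S" "S \<subseteq> Vset G"
  shows "X (insert (want G j) S) \<le> X S"
  using assms by (intro lp_feasible_decodes [OF assms(1)]) (auto simp: decodes_def bsi_wf_def)

text \<open>Every constraint on nested sets telescopes along a chain that adds one message at a
  time. For decoding, what a receiver knows lies in \<open>A\<close> and hence in every later set of
  the chain.\<close>

lemma lp_feasibleI: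
  fixes X :: "nat set \<Rightarrow> real"
  assumes wf: "bsi_wf G"
    and V: "real (nmsg G) \<le> X (Vset G)" and nonneg: "0 \<le> X {}"
    and mono: "\<And>S x. S \<subseteq> Vset G \<Longrightarrow> x \<in> Vset G - S \<Longrightarrow> X S \<le> X (insert x S)"
    and slope: "\<And>S x. S \<subseteq> Vset G \<Longrightarrow> x \<in> Vset G - S \<Longrightarrow> X (insert x S) \<le> X S + 1"
    and receiver: "\<And>j S. j < nrec G \<Longrightarrow> know G j \<subseteq> S \<Longrightarrow> S \<subseteq> Vset G \<Longrightarrow> want G j \<notin> S \<Longrightarrow>
        X (insert (want G j) S) \<le> X S"
    and alternating: "\<And>R Z. R \<subseteq> Vset G \<Longrightarrow> 2 \<le> card R \<Longrightarrow> card R \<le> k \<Longrightarrow> Z \<subseteq> Vset G \<Longrightarrow>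
        Z \<inter> R = {} \<Longrightarrow> alternating_sum R X Z \<le> 0"
  shows "lp_feasible G k X"
proof -
  have "X T \<le> X S + real (card (T - S))" if "S \<subseteq> T" "T \<subseteq> Vset G" for S T
    using that(1) finite_subset_Vset [OF that(2)]
  proof (induction rule: subset_insert_induct)
    case (step U x)
    have "insert x U - S = insert x (U - S)" "x \<notin> U - S" "finite (U - S)"
      using step that finite_subset_Vset [of U G] by auto
    then have "card (insert x U - S) = Suc (card (U - S))" by simp
    moreover have "U \<subseteq> Vset G" "x \<in> Vset G - U" using step that by auto
    ultimately show ?case using step slope [of U x] by simp
  qed simp
  moreover have "X S \<le> X T" if "S \<subseteq> T" "T \<subseteq> Vset G" for S T
    using that(1) finite_subset_Vset [OF that(2)]
  proof (induction rule: subset_insert_induct)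
    case (step U x)
    then have "U \<subseteq> Vset G" "x \<in> Vset G - U" using that by auto
    then show ?case using step mono [of U x] by simp
  qed simp
  moreover have "X B \<le> X A" if B: "B \<subseteq> Vset G" and AB: "decodes G A B" for A B
  proof -
    have "A \<subseteq> B" using AB by (simp add: decodes_def)
    then show ?thesis using finite_subset_Vset [OF B]
    proof (induction rule: subset_insert_induct)
      case (step U x)
      then have "x \<in> B - A" by auto
      then obtain j where "j < nrec G" "want G j = x" "know G j \<subseteq> A"
        using AB unfolding decodes_def by meson
      moreover have "U \<subseteq> Vset G" "know G j \<subseteq> U" using step B calculation by auto
      ultimately show ?case using receiver [of j U] step by auto
    qed simp
  qed
  ultimately show ?thesis
    using V nonneg alternating unfolding lp_feasible_def alternating_sum_def by simp
qed

text \<open>Diminishing returns: the gain from adding \<open>want G j\<close> can only shrink as the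
  base set grows from \<open>know G j\<close> to \<open>S\<close>.\<close>

lemma submodular_receiver:
  fixes X :: "nat set \<Rightarrow> real"
  assumes wf: "bsi_wf G" and j: "j < nrec G" "know G j \<subseteq> S" "S \<subseteq> Vset G" "want G j \<notin> S"
    and submod: "\<And>S x y. S \<subseteq> Vset G \<Longrightarrow> x \<in> Vset G - S \<Longrightarrow> y \<in> Vset G - S \<Longrightarrow> x \<noteq> y \<Longrightarrow>
        X (insert x (insert y S)) + X S \<le> X (insert x S) + X (insert y S)"
    and know: "X (insert (want G j) (know G j)) \<le> X (know G j)"
  shows "X (insert (want G j) S) \<le> X S"
  using j(2) finite_subset_Vset [OF j(3)]
proof (induction rule: subset_insert_induct)
  case (step U x)
  show ?case
  proof (cases "x = want G j")
    case False
    then have "U \<subseteq> Vset G" "x \<in> Vset G - U" "want G j \<in> Vset G - U"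
      using step j wf by (auto simp: bsi_wf_def)
    then show ?thesis
      using submod [of U "want G j" x] False step.IH by simp
  qed simp
qed (rule know)

lemma lp_feasible_submodularI:
  fixes X :: "nat set \<Rightarrow> real"
  assumes wf: "bsi_wf G"
    and V: "real (nmsg G) \<le> X (Vset G)" and nonneg: "0 \<le> X {}"
    and mono: "\<And>S x. S \<subseteq> Vset G \<Longrightarrow> x \<in> Vset G - S \<Longrightarrow> X S \<le> X (insert x S)"
    and slope: "\<And>S x. S \<subseteq> Vset G \<Longrightarrow> x \<in> Vset G - S \<Longrightarrow> X (insert x S) \<le> X S + 1"
    and submod: "\<And>S x y. S \<subseteq> Vset G \<Longrightarrow> x \<in> Vset G - S \<Longrightarrow> y \<in> Vset G - S \<Longrightarrow> x \<noteq> y \<Longrightarrow>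
        X (insert x (insert y S)) + X S \<le> X (insert x S) + X (insert y S)"
    and receiver: "\<And>j. j < nrec G \<Longrightarrow> X (insert (want G j) (know G j)) \<le> X (know G j)"
  shows "lp_feasible G 2 X"
proof (rule lp_feasibleI [OF wf V nonneg mono slope])
  fix j S assume j: "j < nrec G" "know G j \<subseteq> S" "S \<subseteq> Vset G" "want G j \<notin> S"
  show "X (insert (want G j) S) \<le> X S"
    by (rule submodular_receiver [OF wf j submod receiver [OF j(1)]])
next
  fix R Z assume R: "R \<subseteq> Vset G" "2 \<le> card R" "card R \<le> 2" "Z \<subseteq> Vset G" "Z \<inter> R = {}"
  then obtain x y where "R = {x, y}" "x \<noteq> y"
    using card_2_iff [of R] by auto
  then show "alternating_sum R X Z \<le> 0"
    using submod [of Z x y] R by (auto simp: alternating_sum_pair)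
qed auto

text \<open>Broadcasting all messages uncoded. This point keeps the set of LP values nonempty, which
  lower bounds on its \<open>Inf\<close> require.\<close>

lemma lp_feasible_const: "lp_feasible G k (\<lambda>_. real (nmsg G))"
proof -
  have "(\<Sum>T\<in>Pow R. (-1) ^ card (R - T) * real (nmsg G)) = 0"
    if "R \<subseteq> Vset G" "2 \<le> card R" for R
  proof -
    have "R \<noteq> {}" using that by auto
    then show ?thesis
      using alternating_sum_const [of R "real (nmsg G)" "{}"] that finite_subset_Vset [of R G]
      by (simp add: alternating_sum_def)
  qed
  then show ?thesis unfolding lp_feasible_def by auto
qed

lemma bdd_below_lp_values: "bdd_below {X {} | X. lp_feasible G k X}"
  by (rule bdd_belowI [where m = 0]) (auto simp: lp_feasible_nonneg)

lemma lp_value_le: "lp_feasible G k X \<Longrightarrow> lp_value G k \<le> X {}"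
  unfolding lp_value_def using bdd_below_lp_values by (intro cInf_lower) auto

lemma lp_value_ge: "(\<And>X. lp_feasible G k X \<Longrightarrow> c \<le> X {}) \<Longrightarrow> c \<le> lp_value G k"
  unfolding lp_value_def using lp_feasible_const by (intro cInf_greatest) auto

lemma lp_feasible_antimono: "lp_feasible G l X \<Longrightarrow> k \<le> l \<Longrightarrow> lp_feasible G k X"
  unfolding lp_feasible_def by auto

lemma lp_value_mono: "k \<le> l \<Longrightarrow> lp_value G k \<le> lp_value G l"
  by (rule lp_value_ge) (auto intro: lp_value_le dest: lp_feasible_antimono)

subsection \<open>Entropy on finite probability spaces\<close>

locale finite_distribution =
  fixes \<Omega> :: "'a set" and p :: "'a \<Rightarrow> real"
  assumes finite [simp]: "finite \<Omega>"
    and pos: "x \<in> \<Omega> \<Longrightarrow> 0 < p x"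
    and total: "sum p \<Omega> = 1"
begin

text \<open>The probability of the event f = f x, indexed by the point \<open>x\<close> rather than
  by the value. Entropy becomes a plain expectation over \<open>\<Omega>\<close>, and variables of
  different types are compared without mentioning their ranges.\<close>

definition mass :: "('a \<Rightarrow> 'b) \<Rightarrow> 'a \<Rightarrow> real" where
  "mass f x = (\<Sum>y\<in>\<Omega>. if f y = f x then p y else 0)"

definition entropy :: "('a \<Rightarrow> 'b) \<Rightarrow> real" where
  "entropy f = (\<Sum>x\<in>\<Omega>. p x * log 2 (1 / mass f x))"

lemma nonneg: "x \<in> \<Omega> \<Longrightarrow> 0 \<le> p x"
  by (rule less_imp_le) (rule pos)

lemma mass_pos: "x \<in> \<Omega> \<Longrightarrow> 0 < mass f x"
  unfolding mass_def by (intro sum_pos2 [of \<Omega> x]) (simp_all add: pos nonneg)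

lemma mass_cong: "f x = f y \<Longrightarrow> mass f x = mass f y"
  by (simp add: mass_def)

lemma mass_mono:
  assumes "x \<in> \<Omega>" "\<And>y. y \<in> \<Omega> \<Longrightarrow> f y = f x \<Longrightarrow> g y = g x"
  shows "mass f x \<le> mass g x"
  unfolding mass_def
proof (rule sum_mono)
  fix y assume "y \<in> \<Omega>"
  then show "(if f y = f x then p y else 0) \<le> (if g y = g x then p y else 0)"
    using assms(2) [of y] by (simp add: nonneg)
qed

lemma sum_div_mass:
  assumes "a \<in> \<Omega>"
  shows "(\<Sum>x\<in>\<Omega>. if f x = f a then p x / mass f x else 0) = 1"
proof -
  have "(\<Sum>x\<in>\<Omega>. if f x = f a then p x / mass f x else 0)
      = (\<Sum>x\<in>\<Omega>. (if f x = f a then p x else 0) / mass f a)"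
    by (intro sum.cong) (auto simp: mass_def)
  also have "\<dots> = mass f a / mass f a"
    by (subst sum_divide_distrib [symmetric]) (simp add: mass_def [of f a])
  finally show ?thesis using mass_pos [OF assms, of f] by simp
qed

text \<open>The ratio compares the law making \<open>f\<close> and \<open>g\<close> conditionally
  independent given \<open>h\<close> with their true joint law. Its expectation is the mass that the
  former puts on the attained pairs of values, hence at most 1.\<close>

lemma sum_mass_ratio_le_1:
  assumes fh: "\<And>x y. x \<in> \<Omega> \<Longrightarrow> y \<in> \<Omega> \<Longrightarrow> f x = f y \<Longrightarrow> h x = h y"
    and gh: "\<And>x y. x \<in> \<Omega> \<Longrightarrow> y \<in> \<Omega> \<Longrightarrow> g x = g y \<Longrightarrow> h x = h y"
  shows "(\<Sum>x\<in>\<Omega>. p x * (mass f x * mass g x / (mass h x * mass (\<lambda>x. (f x, g x)) x))) \<le> 1"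
proof -
  let ?fg = "\<lambda>x. (f x, g x)"
  have "(\<Sum>x\<in>\<Omega>. p x * (mass f x * mass g x / (mass h x * mass ?fg x)))
      = (\<Sum>x\<in>\<Omega>. \<Sum>a\<in>\<Omega>. \<Sum>b\<in>\<Omega>. if f a = f x \<and> g b = g x
           then p a * p b / mass h a * (p x / mass ?fg x) else 0)"
  proof (rule sum.cong)
    fix x assume x: "x \<in> \<Omega>"
    have *: "mass f x * mass g x = (\<Sum>a\<in>\<Omega>. \<Sum>b\<in>\<Omega>. if f a = f x \<and> g b = g x then p a * p b else 0)"
      unfolding mass_def sum_product by (intro sum.cong) auto
    have "p x * (mass f x * mass g x / (mass h x * mass ?fg x))
        = mass f x * mass g x * (p x / (mass h x * mass ?fg x))"
      by simp
    also have "\<dots> = (\<Sum>a\<in>\<Omega>. \<Sum>b\<in>\<Omega>. (if f a = f x \<and> g b = g x then p a * p b else 0)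
            * (p x / (mass h x * mass ?fg x)))"
      unfolding * sum_distrib_right ..
    also have "\<dots> = (\<Sum>a\<in>\<Omega>. \<Sum>b\<in>\<Omega>. if f a = f x \<and> g b = g x
           then p a * p b / mass h a * (p x / mass ?fg x) else 0)"
    proof (intro sum.cong)
      fix a b assume "a \<in> \<Omega>" "b \<in> \<Omega>"
      then have "f a = f x \<Longrightarrow> mass h a = mass h x"
        using fh [of a x] x by (intro mass_cong) auto
      then show "(if f a = f x \<and> g b = g x then p a * p b else 0) * (p x / (mass h x * mass ?fg x))
          = (if f a = f x \<and> g b = g x then p a * p b / mass h a * (p x / mass ?fg x) else 0)"
        by simp
    qed simp_all
    finally show "p x * (mass f x * mass g x / (mass h x * mass ?fg x)) = \<dots>" .
  qed simp
  also have "\<dots> = (\<Sum>a\<in>\<Omega>. \<Sum>b\<in>\<Omega>. \<Sum>x\<in>\<Omega>. if f a = f x \<and> g b = g x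
           then p a * p b / mass h a * (p x / mass ?fg x) else 0)"
    by (subst sum.swap, rule sum.cong, simp, rule sum.swap)
  \<comment> \<open>For fixed \<open>a\<close>, \<open>b\<close> the sum over \<open>x\<close> runs
    through one fibre of the pair, where the conditional probabilities add up to 1. If that fibre is
    nonempty, a point in it forces h a = h b.\<close>
  also have "\<dots> \<le> (\<Sum>a\<in>\<Omega>. \<Sum>b\<in>\<Omega>. if h b = h a then p a * p b / mass h a else 0)"
  proof (intro sum_mono)
    fix a b assume ab: "a \<in> \<Omega>" "b \<in> \<Omega>"
    show "(\<Sum>x\<in>\<Omega>. if f a = f x \<and> g b = g x then p a * p b / mass h a * (p x / mass ?fg x) else 0)
       \<le> (if h b = h a then p a * p b / mass h a else 0)"
    proof (cases "\<exists>c\<in>\<Omega>. f a = f c \<and> g b = g c")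
      case True
      then obtain c where c: "c \<in> \<Omega>" "f a = f c" "g b = g c" by auto
      have "h b = h a" using fh [of a c] gh [of b c] ab c by simp
      have "(\<Sum>x\<in>\<Omega>. if f a = f x \<and> g b = g x then p a * p b / mass h a * (p x / mass ?fg x) else 0)
         = p a * p b / mass h a * (\<Sum>x\<in>\<Omega>. if ?fg x = ?fg c then p x / mass ?fg x else 0)"
        unfolding sum_distrib_left using c by (intro sum.cong) auto
      then show ?thesis using \<open>h b = h a\<close> sum_div_mass [OF c(1), of ?fg] by simp
    next
      case False
      then have "(\<Sum>x\<in>\<Omega>. if f a = f x \<and> g b = g x then p a * p b / mass h a * (p x / mass ?fg x) else 0) = 0"
        by (intro sum.neutral) auto
      then show ?thesis using ab nonneg mass_pos [of a h] by simp
    qed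
  qed
  also have "\<dots> = (\<Sum>a\<in>\<Omega>. p a / mass h a * (\<Sum>b\<in>\<Omega>. if h b = h a then p b else 0))"
    unfolding sum_distrib_left by (intro sum.cong) auto
  also have "\<dots> = sum p \<Omega>"
  proof (rule sum.cong)
    fix a assume "a \<in> \<Omega>"
    then show "p a / mass h a * (\<Sum>b\<in>\<Omega>. if h b = h a then p b else 0) = p a"
      using mass_pos [of a h] mass_def [of h a] by simp
  qed simp
  finally show ?thesis by (simp add: total)
qed

lemma gibbs:
  assumes "\<And>x. x \<in> \<Omega> \<Longrightarrow> 0 < q x" "(\<Sum>x\<in>\<Omega>. p x * q x) \<le> 1"
  shows "(\<Sum>x\<in>\<Omega>. p x * log 2 (q x)) \<le> 0"
proof -
  have "(\<Sum>x\<in>\<Omega>. p x * ln (q x)) \<le> (\<Sum>x\<in>\<Omega>. p x * (q x - 1))"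
    using assms(1) nonneg by (intro sum_mono mult_left_mono ln_le_minus_one) auto
  also have "\<dots> \<le> 0"
    using assms(2) by (simp add: right_diff_distrib sum_subtractf total)
  finally have "(\<Sum>x\<in>\<Omega>. p x * ln (q x)) / ln 2 \<le> 0"
    by (simp add: divide_nonpos_pos)
  then show ?thesis by (simp add: log_def sum_divide_distrib)
qed

text \<open>Nonnegativity of conditional mutual information, by \<open>gibbs\<close> applied to the
  ratio above. Asking only that \<open>h\<close> and \<open>m\<close> be determined by
  \<open>f\<close> and \<open>g\<close> lets one lemma yield monotonicity, subadditivity and every
  Shannon inequality used later.\<close>

lemma entropy_submodular:
  assumes fh: "\<And>x y. x \<in> \<Omega> \<Longrightarrow> y \<in> \<Omega> \<Longrightarrow> f x = f y \<Longrightarrow> h x = h y"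
    and gh: "\<And>x y. x \<in> \<Omega> \<Longrightarrow> y \<in> \<Omega> \<Longrightarrow> g x = g y \<Longrightarrow> h x = h y"
    and m: "\<And>x y. x \<in> \<Omega> \<Longrightarrow> y \<in> \<Omega> \<Longrightarrow> f x = f y \<Longrightarrow> g x = g y \<Longrightarrow> m x = m y"
  shows "entropy h + entropy m \<le> entropy f + entropy g"
proof -
  let ?q = "\<lambda>x. mass f x * mass g x / (mass h x * mass m x)"
  have "(\<Sum>x\<in>\<Omega>. p x * ?q x)
      \<le> (\<Sum>x\<in>\<Omega>. p x * (mass f x * mass g x / (mass h x * mass (\<lambda>x. (f x, g x)) x)))"
  proof (intro sum_mono)
    fix x assume x: "x \<in> \<Omega>"
    have "mass (\<lambda>x. (f x, g x)) x \<le> mass m x"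
      using x by (intro mass_mono) (auto intro: m)
    then show "p x * ?q x \<le> p x * (mass f x * mass g x / (mass h x * mass (\<lambda>x. (f x, g x)) x))"
      using nonneg [OF x] mass_pos [OF x, of f] mass_pos [OF x, of g] mass_pos [OF x, of h] mass_pos [OF x, of m]
        mass_pos [OF x, of "\<lambda>x. (f x, g x)"]
      by (intro mult_left_mono divide_left_mono mult_pos_pos) simp_all
  qed
  also have "\<dots> \<le> 1"
    by (rule sum_mass_ratio_le_1) (fact fh gh)+
  finally have "(\<Sum>x\<in>\<Omega>. p x * log 2 (?q x)) \<le> 0"
    by (intro gibbs) (simp_all add: mass_pos)
  moreover have "(\<Sum>x\<in>\<Omega>. p x * log 2 (?q x)) = entropy h + entropy m - entropy f - entropy g"
    unfolding entropy_def sum.distrib [symmetric] sum_subtractf [symmetric]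
  proof (rule sum.cong)
    fix x assume x: "x \<in> \<Omega>"
    show "p x * log 2 (?q x) = p x * log 2 (1 / mass h x) + p x * log 2 (1 / mass m x)
        - p x * log 2 (1 / mass f x) - p x * log 2 (1 / mass g x)"
      using mass_pos [OF x, of f] mass_pos [OF x, of g] mass_pos [OF x, of h] mass_pos [OF x, of m]
      by (simp add: log_divide log_mult algebra_simps)
  qed simp
  ultimately show ?thesis by simp
qed

lemma entropy_mono:
  assumes "\<And>x y. x \<in> \<Omega> \<Longrightarrow> y \<in> \<Omega> \<Longrightarrow> f x = f y \<Longrightarrow> g x = g y"
  shows "entropy g \<le> entropy f"
proof -
  have "entropy g + entropy f \<le> entropy f + entropy f"
    by (rule entropy_submodular) (fact assms)+
  then show ?thesis by simp
qed

lemma entropy_cong: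
  assumes "\<And>x y. x \<in> \<Omega> \<Longrightarrow> y \<in> \<Omega> \<Longrightarrow> f x = f y \<longleftrightarrow> g x = g y"
  shows "entropy f = entropy g"
  by (intro antisym entropy_mono) (simp_all only: assms)

lemma entropy_const: "entropy (\<lambda>_. c) = 0"
  by (simp add: entropy_def mass_def total)

lemma entropy_nonneg: "0 \<le> entropy f"
  using entropy_mono [of f "\<lambda>_. ()"] by (simp add: entropy_const)

lemma nonempty: "\<Omega> \<noteq> {}"
  using total by auto

text \<open>\<open>gibbs\<close> again, now with the ratio of the uniform law on \<open>K\<close> to
  the law of \<open>f\<close>.\<close>

lemma entropy_le_log_card:
  assumes "f ` \<Omega> \<subseteq> K" "finite K"
  shows "entropy f \<le> log 2 (real (card K))"
proof -
  have K: "0 < card K"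
    using assms nonempty by (auto simp: card_gt_0_iff)
  let ?q = "\<lambda>x. 1 / (real (card K) * mass f x)"
  have "(\<Sum>x\<in>\<Omega>. p x * ?q x) = (\<Sum>x\<in>\<Omega>. \<Sum>k\<in>K. if f x = k then p x * ?q x else 0)"
    using assms by (intro sum.cong) (auto simp: sum.delta)
  also have "\<dots> = (\<Sum>k\<in>K. \<Sum>x\<in>\<Omega>. if f x = k then p x * ?q x else 0)"
    by (rule sum.swap)
  also have "\<dots> \<le> (\<Sum>k\<in>K. 1 / real (card K))"
  proof (rule sum_mono)
    fix k
    show "(\<Sum>x\<in>\<Omega>. if f x = k then p x * ?q x else 0) \<le> 1 / real (card K)"
    proof (cases "\<exists>a\<in>\<Omega>. f a = k")
      case True
      then obtain a where a: "a \<in> \<Omega>" "f a = k" by auto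
      have "(\<Sum>x\<in>\<Omega>. if f x = k then p x * ?q x else 0)
          = 1 / real (card K) * (\<Sum>x\<in>\<Omega>. if f x = f a then p x / mass f x else 0)"
        unfolding sum_distrib_left a by (intro sum.cong) auto
      then show ?thesis using sum_div_mass [OF a(1), of f] by simp
    next
      case False
      then have "(\<Sum>x\<in>\<Omega>. if f x = k then p x * ?q x else 0) = 0"
        by (intro sum.neutral) auto
      then show ?thesis by simp
    qed
  qed
  also have "\<dots> = 1" using K by simp
  finally have "(\<Sum>x\<in>\<Omega>. p x * log 2 (?q x)) \<le> 0"
    using K by (intro gibbs) (simp_all add: mass_pos)
  moreover have "(\<Sum>x\<in>\<Omega>. p x * log 2 (?q x)) = (\<Sum>x\<in>\<Omega>. p x * log 2 (1 / mass f x) - p x * log 2 (real (card K)))"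
  proof (rule sum.cong)
    fix x assume x: "x \<in> \<Omega>"
    show "p x * log 2 (?q x) = p x * log 2 (1 / mass f x) - p x * log 2 (real (card K))"
      using mass_pos [OF x, of f] K by (simp add: log_divide log_mult algebra_simps)
  qed simp
  ultimately show ?thesis
    by (simp add: entropy_def sum_subtractf total flip: sum_distrib_right)
qed

section \<open>Conditionally independent copies and the Zhang-Yeung inequality\<close>

definition fibre_product :: "('a \<Rightarrow> 'c) \<Rightarrow> ('a \<times> 'a) set" where
  "fibre_product c = {(x, y). x \<in> \<Omega> \<and> y \<in> \<Omega> \<and> c x = c y}"

text \<open>The law of drawing x from \<open>p\<close> and then y from \<open>p\<close> conditioned
  on having the same value of \<open>c\<close>. It is symmetric, so both marginals are
  \<open>p\<close>.\<close>

definition fibre_prob :: "('a \<Rightarrow> 'c) \<Rightarrow> 'a \<times> 'a \<Rightarrow> real" where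
  "fibre_prob c = (\<lambda>(x, y). p x * p y / mass c x)"

lemma sum_fibre:
  "(\<Sum>z\<in>fibre_product c. F z) = (\<Sum>x\<in>\<Omega>. \<Sum>y\<in>\<Omega>. if c x = c y then F (x, y) else (0::real))"
proof -
  have "(\<Sum>z\<in>fibre_product c. F z)
      = (\<Sum>z\<in>\<Omega>\<times>\<Omega>. if c (fst z) = c (snd z) then F z else 0)"
    by (rule sum.mono_neutral_cong_left) (auto simp: fibre_product_def)
  then show ?thesis
    unfolding sum.cartesian_product by (simp add: split_beta cong: if_cong)
qed

lemma sum_fibre_fst:
  "(\<Sum>z\<in>fibre_product c. fibre_prob c z * F (fst z)) = (\<Sum>x\<in>\<Omega>. p x * F x)"
  unfolding sum_fibre
proof (rule sum.cong)
  fix x assume x: "x \<in> \<Omega>"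
  have "(\<Sum>y\<in>\<Omega>. if c x = c y then fibre_prob c (x, y) * F (fst (x, y)) else 0)
     = p x * F x / mass c x * (\<Sum>y\<in>\<Omega>. if c y = c x then p y else 0)"
    unfolding sum_distrib_left by (intro sum.cong) (auto simp: fibre_prob_def)
  then show "(\<Sum>y\<in>\<Omega>. if c x = c y then fibre_prob c (x, y) * F (fst (x, y)) else 0) = p x * F x"
    using mass_pos [OF x, of c] mass_def [of c x] by simp
qed simp

lemma sum_fibre_snd:
  "(\<Sum>z\<in>fibre_product c. fibre_prob c z * F (snd z)) = (\<Sum>x\<in>\<Omega>. p x * F x)"
proof -
  have "(\<Sum>z\<in>fibre_product c. fibre_prob c z * F (snd z))
      = (\<Sum>z\<in>fibre_product c. fibre_prob c z * F (fst z))"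
  proof (rule sum.reindex_bij_witness [of _ prod.swap prod.swap])
    fix z assume "z \<in> fibre_product c"
    then have "mass c (fst z) = mass c (snd z)"
      by (intro mass_cong) (auto simp: fibre_product_def)
    then show "fibre_prob c (prod.swap z) * F (fst (prod.swap z)) = fibre_prob c z * F (snd z)"
      by (simp add: fibre_prob_def split_beta mult.commute)
  qed (auto simp: fibre_product_def)
  then show ?thesis by (simp add: sum_fibre_fst)
qed

lemma fibre_distribution: "finite_distribution (fibre_product c) (fibre_prob c)"
proof
  show "finite (fibre_product c)"
    by (rule finite_subset [of _ "\<Omega> \<times> \<Omega>"]) (auto simp: fibre_product_def)
  show "0 < fibre_prob c z" if "z \<in> fibre_product c" for z
    using that by (auto simp: fibre_product_def fibre_prob_def intro!: divide_pos_pos mult_pos_pos pos mass_pos)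
  show "sum (fibre_prob c) (fibre_product c) = 1"
    using sum_fibre_fst [of c "\<lambda>_. 1"] by (simp add: total)
qed

lemma entropy_fibre_fst:
  "finite_distribution.entropy (fibre_product c) (fibre_prob c) (\<lambda>z. f (fst z)) = entropy f"
proof -
  interpret D: finite_distribution "fibre_product c" "fibre_prob c"
    by (rule fibre_distribution)
  have "D.mass (\<lambda>z. f (fst z)) z = mass f (fst z)" for z
    using sum_fibre_fst [of c "\<lambda>x. if f x = f (fst z) then 1 else 0"]
    by (simp add: D.mass_def mass_def if_distrib cong: if_cong)
  then show ?thesis
    by (simp add: D.entropy_def entropy_def sum_fibre_fst [of c "\<lambda>x. log 2 (1 / mass f x)"])
qed

lemma entropy_fibre_snd:
  "finite_distribution.entropy (fibre_product c) (fibre_prob c) (\<lambda>z. f (snd z)) = entropy f"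
proof -
  interpret D: finite_distribution "fibre_product c" "fibre_prob c"
    by (rule fibre_distribution)
  have "D.mass (\<lambda>z. f (snd z)) z = mass f (snd z)" for z
    using sum_fibre_snd [of c "\<lambda>x. if f x = f (snd z) then 1 else 0"]
    by (simp add: D.mass_def mass_def if_distrib cong: if_cong)
  then show ?thesis
    by (simp add: D.entropy_def entropy_def sum_fibre_snd [of c "\<lambda>x. log 2 (1 / mass f x)"])
qed

text \<open>Conditional independence of the two coordinates given the common value of \<open>c\<close>.\<close>

lemma entropy_fibre_pair:
  assumes f: "\<And>x y. x \<in> \<Omega> \<Longrightarrow> y \<in> \<Omega> \<Longrightarrow> f x = f y \<Longrightarrow> c x = c y"
    and g: "\<And>x y. x \<in> \<Omega> \<Longrightarrow> y \<in> \<Omega> \<Longrightarrow> g x = g y \<Longrightarrow> c x = c y"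
  shows "finite_distribution.entropy (fibre_product c) (fibre_prob c) (\<lambda>z. (f (fst z), g (snd z)))
      = entropy f + entropy g - entropy c"
proof -
  interpret D: finite_distribution "fibre_product c" "fibre_prob c"
    by (rule fibre_distribution)
  have mass: "D.mass (\<lambda>z. (f (fst z), g (snd z))) z = mass f (fst z) * mass g (snd z) / mass c (fst z)"
    if z: "z \<in> fibre_product c" for z
  proof -
    obtain x y where xy: "z = (x, y)" "x \<in> \<Omega>" "y \<in> \<Omega>" "c x = c y"
      using z by (auto simp: fibre_product_def)
    have "D.mass (\<lambda>z. (f (fst z), g (snd z))) z
       = (\<Sum>a\<in>\<Omega>. \<Sum>b\<in>\<Omega>. (if f a = f x then p a else 0) * (if g b = g y then p b else 0) / mass c x)"
      unfolding D.mass_def sum_fibre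
    proof (intro sum.cong)
      fix a b assume ab: "a \<in> \<Omega>" "b \<in> \<Omega>"
      have "f a = f x \<Longrightarrow> g b = g y \<Longrightarrow> c a = c b"
        using f [OF ab(1) xy(2)] g [OF ab(2) xy(3)] xy by simp
      moreover have "f a = f x \<Longrightarrow> mass c a = mass c x"
        using f [OF ab(1) xy(2)] by (intro mass_cong)
      ultimately show "(if c a = c b then if (f (fst (a, b)), g (snd (a, b))) = (f (fst z), g (snd z))
            then fibre_prob c (a, b) else 0 else 0)
          = (if f a = f x then p a else 0) * (if g b = g y then p b else 0) / mass c x"
        by (auto simp: fibre_prob_def xy(1))
    qed simp_all
    also have "\<dots> = mass f x * mass g y / mass c x"
      unfolding mass_def [of f] mass_def [of g] by (simp add: sum_product sum_divide_distrib)
    finally show ?thesis by (simp add: xy)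
  qed
  have "D.entropy (\<lambda>z. (f (fst z), g (snd z)))
     = (\<Sum>z\<in>fibre_product c. fibre_prob c z * log 2 (1 / mass f (fst z))
         + fibre_prob c z * log 2 (1 / mass g (snd z)) - fibre_prob c z * log 2 (1 / mass c (fst z)))"
    unfolding D.entropy_def
  proof (rule sum.cong)
    fix z assume z: "z \<in> fibre_product c"
    have "fst z \<in> \<Omega>" "snd z \<in> \<Omega>" using z by (auto simp: fibre_product_def)
    then have "0 < mass f (fst z)" "0 < mass g (snd z)" "0 < mass c (fst z)"
      by (auto intro: mass_pos)
    then show "fibre_prob c z * log 2 (1 / D.mass (\<lambda>z. (f (fst z), g (snd z))) z)
       = fibre_prob c z * log 2 (1 / mass f (fst z))
         + fibre_prob c z * log 2 (1 / mass g (snd z)) - fibre_prob c z * log 2 (1 / mass c (fst z))"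
      by (simp add: mass [OF z] log_divide log_mult algebra_simps)
  qed simp
  then show ?thesis
    by (simp add: sum.distrib sum_subtractf entropy_def
        sum_fibre_fst [of c "\<lambda>x. log 2 (1 / mass f x)"]
        sum_fibre_fst [of c "\<lambda>x. log 2 (1 / mass c x)"]
        sum_fibre_snd [of c "\<lambda>x. log 2 (1 / mass g x)"])
qed

text \<open>The Zhang--Yeung inequality. The fibre product over \<open>(C, D)\<close> adjoins to \<open>A, B, C, D\<close> (read off
  the first coordinate) a copy \<open>R\<close> of \<open>A\<close> (read off the second) with the same joint distribution
  with \<open>(C, D)\<close>, independent of \<open>(A, B)\<close> given \<open>(C, D)\<close>; the claim is then a combination of
  Shannon inequalities for the five variables.\<close>

lemma zhang_yeung:
  fixes A :: "'a \<Rightarrow> 'b" and B :: "'a \<Rightarrow> 'c" and C :: "'a \<Rightarrow> 'd" and D :: "'a \<Rightarrow> 'e"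
  defines "AB \<equiv> \<lambda>x. (A x, B x)" and "AC \<equiv> \<lambda>x. (A x, C x)" and "AD \<equiv> \<lambda>x. (A x, D x)"
    and "BC \<equiv> \<lambda>x. (B x, C x)" and "BD \<equiv> \<lambda>x. (B x, D x)" and "CD \<equiv> \<lambda>x. (C x, D x)"
    and "ACD \<equiv> \<lambda>x. (A x, C x, D x)" and "BCD \<equiv> \<lambda>x. (B x, C x, D x)"
  shows "2 * (entropy C + entropy D - entropy CD)
    \<le> (entropy A + entropy B - entropy AB) + (entropy A + entropy CD - entropy ACD)
     + 3 * (entropy AC + entropy AD - entropy ACD - entropy A)
     + (entropy BC + entropy BD - entropy BCD - entropy B)"
proof -
  define ABCD where "ABCD = (\<lambda>x. (A x, B x, C x, D x))"
  note defs = AB_def AC_def AD_def BC_def BD_def CD_def ACD_def BCD_def ABCD_def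
  interpret J: finite_distribution "fibre_product CD" "fibre_prob CD"
    by (rule fibre_distribution)
  \<comment> \<open>Since \<open>C\<close> and \<open>D\<close> can be read off either coordinate,
    the copy of \<open>A\<close> joined with them can be moved entirely to the second coordinate,
    where it has the original law.\<close>
  have CD: "C (fst z) = C (snd z)" "D (fst z) = D (snd z)" if "z \<in> fibre_product CD" for z
    using that by (auto simp: fibre_product_def CD_def)
  let ?R = "\<lambda>z. A (snd z)"
  let ?j = "\<lambda>f z. (f (fst z), A (snd z))"
  have R: "J.entropy ?R = entropy A"
    "J.entropy (?j C) = entropy AC" "J.entropy (?j D) = entropy AD" "J.entropy (?j CD) = entropy ACD"
  proof -
    show "J.entropy ?R = entropy A" by (rule entropy_fibre_snd)
    have "J.entropy (?j C) = J.entropy (\<lambda>z. AC (snd z))"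
      by (rule J.entropy_cong) (auto simp: defs CD)
    then show "J.entropy (?j C) = entropy AC" by (simp add: entropy_fibre_snd)
    have "J.entropy (?j D) = J.entropy (\<lambda>z. AD (snd z))"
      by (rule J.entropy_cong) (auto simp: defs CD)
    then show "J.entropy (?j D) = entropy AD" by (simp add: entropy_fibre_snd)
    have "J.entropy (?j CD) = J.entropy (\<lambda>z. ACD (snd z))"
      by (rule J.entropy_cong) (auto simp: defs CD)
    then show "J.entropy (?j CD) = entropy ACD" by (simp add: entropy_fibre_snd)
  qed
  have indep: "J.entropy (?j ABCD) = entropy ABCD + entropy ACD - entropy CD"
    "J.entropy (?j ACD) = entropy ACD + entropy ACD - entropy CD"
    "J.entropy (?j BCD) = entropy BCD + entropy ACD - entropy CD"
  proof -
    have "J.entropy (\<lambda>z. (ABCD (fst z), ACD (snd z))) = entropy ABCD + entropy ACD - entropy CD"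
      by (rule entropy_fibre_pair) (auto simp: defs)
    moreover have "J.entropy (\<lambda>z. (ABCD (fst z), ACD (snd z))) = J.entropy (?j ABCD)"
      by (rule J.entropy_cong) (auto simp: defs CD)
    ultimately show "J.entropy (?j ABCD) = entropy ABCD + entropy ACD - entropy CD" by simp
    have "J.entropy (\<lambda>z. (ACD (fst z), ACD (snd z))) = entropy ACD + entropy ACD - entropy CD"
      by (rule entropy_fibre_pair) (auto simp: defs)
    moreover have "J.entropy (\<lambda>z. (ACD (fst z), ACD (snd z))) = J.entropy (?j ACD)"
      by (rule J.entropy_cong) (auto simp: defs CD)
    ultimately show "J.entropy (?j ACD) = entropy ACD + entropy ACD - entropy CD" by simp
    have "J.entropy (\<lambda>z. (BCD (fst z), ACD (snd z))) = entropy BCD + entropy ACD - entropy CD"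
      by (rule entropy_fibre_pair) (auto simp: defs)
    moreover have "J.entropy (\<lambda>z. (BCD (fst z), ACD (snd z))) = J.entropy (?j BCD)"
      by (rule J.entropy_cong) (auto simp: defs CD)
    ultimately show "J.entropy (?j BCD) = entropy BCD + entropy ACD - entropy CD" by simp
  qed
  \<comment> \<open>As conditional mutual informations: I(A;B|R), I(R;C,D|A,B), I(C;D|A,R),
    I(A;R|C), I(A;R|D), I(C;D|B,R), I(B;R|C), I(B;R|D). Added with coefficient one they give the
    claim: the terms with the copy that \<open>R\<close> and \<open>indep\<close> do not evaluate
    cancel, and so does the entropy of \<open>ABCD\<close>.\<close>
  have *: "J.entropy ?R + J.entropy (?j AB) \<le> J.entropy (?j A) + J.entropy (?j B)"
    "J.entropy (\<lambda>z. AB (fst z)) + J.entropy (?j ABCD) \<le> J.entropy (?j AB) + J.entropy (\<lambda>z. ABCD (fst z))"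
    "J.entropy (?j A) + J.entropy (?j ACD) \<le> J.entropy (?j AC) + J.entropy (?j AD)"
    "J.entropy (\<lambda>z. C (fst z)) + J.entropy (?j AC) \<le> J.entropy (\<lambda>z. AC (fst z)) + J.entropy (?j C)"
    "J.entropy (\<lambda>z. D (fst z)) + J.entropy (?j AD) \<le> J.entropy (\<lambda>z. AD (fst z)) + J.entropy (?j D)"
    "J.entropy (?j B) + J.entropy (?j BCD) \<le> J.entropy (?j BC) + J.entropy (?j BD)"
    "J.entropy (\<lambda>z. C (fst z)) + J.entropy (?j BC) \<le> J.entropy (\<lambda>z. BC (fst z)) + J.entropy (?j C)"
    "J.entropy (\<lambda>z. D (fst z)) + J.entropy (?j BD) \<le> J.entropy (\<lambda>z. BD (fst z)) + J.entropy (?j D)"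
    by (rule J.entropy_submodular; force simp: defs)+
  show ?thesis
    using * unfolding entropy_fibre_fst R indep by argo
qed

end

subsection \<open>Codes\<close>

lemma restr_eq_iff: "restr x A = restr y A \<longleftrightarrow> (\<forall>i\<in>A. x i = y i)"
  by (auto simp: restr_def fun_eq_iff)

text \<open>A decoder exists once the wanted message is constant on the fibres of what the receiver
  sees: it may pick any consistent message vector.\<close>

lemma is_solution_iff:
  "is_solution G t P E \<longleftrightarrow> finite P \<and> E ` msgs (nmsg G) t \<subseteq> P \<and>
     (\<forall>j<nrec G. \<forall>x\<in>msgs (nmsg G) t. \<forall>y\<in>msgs (nmsg G) t.
        E x = E y \<and> (\<forall>i\<in>know G j. x i = y i) \<longrightarrow> x (want G j) = y (want G j))"
proof -
  have "(\<exists>D :: nat \<Rightarrow> (nat \<Rightarrow> nat) \<Rightarrow> nat. \<forall>x\<in>msgs (nmsg G) t. D (E x) (restr x (know G j)) = x (want G j))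
    \<longleftrightarrow> (\<forall>x\<in>msgs (nmsg G) t. \<forall>y\<in>msgs (nmsg G) t.
        E x = E y \<and> (\<forall>i\<in>know G j. x i = y i) \<longrightarrow> x (want G j) = y (want G j))"
    (is "?L = ?R") for j
  proof
    assume ?R
    define D where "D = (\<lambda>e r. (SOME x. x \<in> msgs (nmsg G) t \<and> E x = e \<and> restr x (know G j) = r) (want G j))"
    have "D (E x) (restr x (know G j)) = x (want G j)" if x: "x \<in> msgs (nmsg G) t" for x
    proof -
      define y where "y = (SOME y. y \<in> msgs (nmsg G) t \<and> E y = E x \<and> restr y (know G j) = restr x (know G j))"
      have "y \<in> msgs (nmsg G) t \<and> E y = E x \<and> restr y (know G j) = restr x (know G j)"
        unfolding y_def by (rule someI [of _ x]) (simp add: x)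
      then have "y (want G j) = x (want G j)"
        using \<open>?R\<close> x by (simp add: restr_eq_iff)
      then show ?thesis by (simp add: D_def y_def)
    qed
    then show ?L by blast
  next
    assume ?L
    then obtain D where D: "\<forall>x\<in>msgs (nmsg G) t. D (E x) (restr x (know G j)) = x (want G j)" ..
    show ?R
    proof (intro ballI impI)
      fix x y assume xy: "x \<in> msgs (nmsg G) t" "y \<in> msgs (nmsg G) t"
        "E x = E y \<and> (\<forall>i\<in>know G j. x i = y i)"
      then have "restr x (know G j) = restr y (know G j)" by (simp add: restr_eq_iff)
      then show "x (want G j) = y (want G j)"
        using D [rule_format, OF xy(1)] D [rule_format, OF xy(2)] xy(3) by simp
    qed
  qed
  then show ?thesis unfolding is_solution_def by simp
qed

lemma bij_betw_msgs:
  "bij_betw (\<lambda>x. restrict x {0..<n}) (msgs n t) ({0..<n} \<rightarrow>\<^sub>E {0..<2 ^ t})"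
  by (rule bij_betw_byWitness [where f' = "\<lambda>f i. if i < n then f i else 0"])
     (auto simp: msgs_def fun_eq_iff PiE_iff extensional_def)

lemma finite_msgs [simp]: "finite (msgs n t)"
  using bij_betw_finite [OF bij_betw_msgs] by (simp add: finite_PiE)

lemma card_msgs: "card (msgs n t) = 2 ^ (n * t)"
  using bij_betw_same_card [OF bij_betw_msgs, of n t]
  by (simp add: card_PiE flip: power_mult)

lemma msgs_nonempty: "msgs n t \<noteq> {}"
  using card_msgs [of n t] by auto

lemma ex_solution: "\<exists>P E. is_solution G t P E"
proof -
  obtain E :: "(nat \<Rightarrow> nat) \<Rightarrow> nat" and k where "inj_on E (msgs (nmsg G) t)"
    using finite_imp_inj_to_nat_seg [OF finite_msgs] by blast
  then have "is_solution G t (E ` msgs (nmsg G) t) E"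
    by (auto simp: is_solution_iff dest: inj_onD)
  then show ?thesis by blast
qed

lemma card_solution_pos: "is_solution G t P E \<Longrightarrow> 0 < card P"
  using msgs_nonempty by (fastforce simp: is_solution_iff card_gt_0_iff)

lemma broadcast_rate_le:
  assumes "is_solution G t P E" "1 \<le> t"
  shows "broadcast_rate G \<le> \<lceil>log 2 (real (card P))\<rceil> / real t"
proof -
  have "broadcast_rate G \<le> real (beta_t G t) / real t"
    unfolding broadcast_rate_def using assms(2)
    by (intro cInf_lower bdd_belowI [where m = 0]) auto
  also have "beta_t G t \<le> nat \<lceil>log 2 (real (card P))\<rceil>"
    unfolding beta_t_def using assms(1) by (intro cInf_lower) auto
  then have "real (beta_t G t) / real t \<le> real (nat \<lceil>log 2 (real (card P))\<rceil>) / real t"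
    by (intro divide_right_mono of_nat_mono) simp_all
  also have "0 \<le> log 2 (real (card P))"
    using card_solution_pos [OF assms(1)] by simp
  then have "real (nat \<lceil>log 2 (real (card P))\<rceil>) = \<lceil>log 2 (real (card P))\<rceil>"
    by simp
  finally show ?thesis .
qed

lemma broadcast_rate_ge:
  assumes "\<And>t P E. is_solution G t P E \<Longrightarrow> 1 \<le> t \<Longrightarrow> c \<le> log 2 (real (card P)) / real t"
  shows "c \<le> broadcast_rate G"
  unfolding broadcast_rate_def
proof (rule cInf_greatest)
  fix r assume "r \<in> (\<lambda>t. real (beta_t G t) / real t) ` {1..}"
  then obtain t where t: "1 \<le> t" "r = real (beta_t G t) / real t" by auto
  have "beta_t G t \<in> {nat \<lceil>log 2 (real (card P))\<rceil> | P E. is_solution G t P E}"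
    unfolding beta_t_def using ex_solution by (intro Inf_nat_def1) blast
  then obtain P E where PE: "is_solution G t P E" "beta_t G t = nat \<lceil>log 2 (real (card P))\<rceil>" by auto
  have "log 2 (real (card P)) \<le> real (beta_t G t)"
    unfolding PE(2) by (simp add: real_nat_ceiling_ge)
  then have "log 2 (real (card P)) / real t \<le> r"
    unfolding t(2) by (simp add: divide_right_mono)
  then show "c \<le> r" using assms [OF PE(1) t(1)] by simp
qed auto

section \<open>The entropy function of a code as a feasible point\<close>

locale index_code =
  fixes G :: bsi and t :: nat and P :: "nat set" and E :: "(nat \<Rightarrow> nat) \<Rightarrow> nat"
  assumes wf: "bsi_wf G" and solution: "is_solution G t P E" and t: "1 \<le> t"
begin

sublocale finite_distribution "msgs (nmsg G) t" "\<lambda>_. 1 / real (card (msgs (nmsg G) t))"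
  by unfold_locales (simp_all add: card_msgs)

definition rate :: "nat set \<Rightarrow> real" where
  "rate S = entropy (\<lambda>x. (E x, restr x S)) / real t"

lemma rate_mono: "S \<subseteq> T \<Longrightarrow> rate S \<le> rate T"
  unfolding rate_def by (intro divide_right_mono entropy_mono) (auto simp: restr_eq_iff)

lemma rate_submodular:
  "rate (S \<inter> T) + rate (S \<union> T) \<le> rate S + rate T"
proof -
  have "entropy (\<lambda>x. (E x, restr x (S \<inter> T))) + entropy (\<lambda>x. (E x, restr x (S \<union> T)))
     \<le> entropy (\<lambda>x. (E x, restr x S)) + entropy (\<lambda>x. (E x, restr x T))"
    by (rule entropy_submodular) (auto simp: restr_eq_iff)
  then show ?thesis
    unfolding rate_def by (simp add: divide_right_mono flip: add_divide_distrib)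
qed

lemma rate_slope:
  assumes "v < nmsg G"
  shows "rate (insert v S) \<le> rate S + 1"
proof -
  \<comment> \<open>A constant in the role of the common part turns submodularity into
    subadditivity.\<close>
  have "entropy (\<lambda>_. ()) + entropy (\<lambda>x. (E x, restr x (insert v S)))
      \<le> entropy (\<lambda>x. (E x, restr x S)) + entropy (\<lambda>x. x v)"
    by (rule entropy_submodular) (auto simp: restr_eq_iff)
  moreover have "entropy (\<lambda>x. x v) \<le> log 2 (real (card {0..<(2::nat) ^ t}))"
    using assms by (intro entropy_le_log_card) (auto simp: msgs_def)
  ultimately have "entropy (\<lambda>x. (E x, restr x (insert v S))) \<le> entropy (\<lambda>x. (E x, restr x S)) + real t"
    by (simp add: entropy_const)
  then show ?thesis
    unfolding rate_def using t by (simp add: field_simps)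
qed

lemma rate_Vset: "rate (Vset G) = real (nmsg G)"
proof -
  have "entropy (\<lambda>x. (E x, restr x (Vset G))) = log 2 (real (card (msgs (nmsg G) t)))"
  proof -
    have "mass (\<lambda>x. (E x, restr x (Vset G))) x = 1 / real (card (msgs (nmsg G) t))"
      if x: "x \<in> msgs (nmsg G) t" for x
    proof -
      have "(E y, restr y (Vset G)) = (E x, restr x (Vset G)) \<longleftrightarrow> y = x" if "y \<in> msgs (nmsg G) t" for y
      proof -
        have "y = x" if "\<forall>i<nmsg G. y i = x i"
        proof
          fix i show "y i = x i"
            using that x \<open>y \<in> msgs (nmsg G) t\<close> by (cases "i < nmsg G") (simp_all add: msgs_def)
        qed
        then show ?thesis by (auto simp: restr_eq_iff Vset_def)
      qed
      then have "mass (\<lambda>x. (E x, restr x (Vset G))) x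
          = (\<Sum>y\<in>msgs (nmsg G) t. if y = x then 1 / real (card (msgs (nmsg G) t)) else 0)"
        unfolding mass_def by (intro sum.cong) simp_all
      then show ?thesis using x by simp
    qed
    then show ?thesis
      using msgs_nonempty by (simp add: entropy_def)
  qed
  then show ?thesis
    using t by (simp add: rate_def card_msgs log_nat_power)
qed

lemma rate_receiver:
  assumes "j < nrec G"
  shows "rate (insert (want G j) (know G j)) \<le> rate (know G j)"
  unfolding rate_def
proof (intro divide_right_mono entropy_mono)
  fix x y assume xy: "x \<in> msgs (nmsg G) t" "y \<in> msgs (nmsg G) t"
    "(E x, restr x (know G j)) = (E y, restr y (know G j))"
  then have "x (want G j) = y (want G j)"
    using solution assms unfolding is_solution_iff by (simp add: restr_eq_iff)
  then show "(E x, restr x (insert (want G j) (know G j))) = (E y, restr y (insert (want G j) (know G j)))"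
    using xy(3) by (simp add: restr_eq_iff)
qed simp

lemma rate_empty: "0 \<le> rate {}" "rate {} \<le> log 2 (real (card P)) / real t"
proof -
  show "0 \<le> rate {}" by (simp add: rate_def entropy_nonneg)
  have "entropy (\<lambda>x. (E x, restr x {})) = entropy E"
    by (rule entropy_cong) (auto simp: restr_eq_iff)
  also have "\<dots> \<le> log 2 (real (card P))"
    using solution by (intro entropy_le_log_card) (auto simp: is_solution_iff)
  finally show "rate {} \<le> log 2 (real (card P)) / real t"
    by (simp add: rate_def divide_right_mono)
qed

lemma rate_feasible: "lp_feasible G 2 rate"
proof (rule lp_feasible_submodularI [OF wf])
  fix S x y assume "S \<subseteq> Vset G" "x \<in> Vset G - S" "y \<in> Vset G - S" "x \<noteq> y"
  moreover from this have "insert x S \<inter> insert y S = S" "insert x S \<union> insert y S = insert x (insert y S)"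
    by auto
  ultimately show "rate (insert x (insert y S)) + rate S \<le> rate (insert x S) + rate (insert y S)"
    using rate_submodular [of "insert x S" "insert y S"] by simp
next
  fix S x assume "S \<subseteq> Vset G" "x \<in> Vset G - S"
  then show "rate (insert x S) \<le> rate S + 1"
    by (intro rate_slope) (simp add: Vset_def)
qed (simp_all add: rate_Vset rate_empty rate_receiver rate_mono subset_insertI)

lemma rate_decodes:
  assumes "j < nrec G" "know G j \<subseteq> S" "S \<subseteq> Vset G"
  shows "rate (insert (want G j) S) = rate S"
  using lp_feasible_receiver [OF rate_feasible wf assms] rate_mono [OF subset_insertI, of S "want G j"] by simp

text \<open>All four variables carry the broadcast word \<open>E\<close> along, so pairing them
  amounts to taking unions of index sets.\<close>

lemma rate_zhang_yeung:
  "2 * (rate C + rate D - rate (C \<union> D))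
    \<le> (rate A + rate B - rate (A \<union> B)) + (rate A + rate (C \<union> D) - rate (A \<union> C \<union> D))
     + 3 * (rate (A \<union> C) + rate (A \<union> D) - rate (A \<union> C \<union> D) - rate A)
     + (rate (B \<union> C) + rate (B \<union> D) - rate (B \<union> C \<union> D) - rate B)"
proof -
  let ?f = "\<lambda>S x. (E x, restr x S)"
  have pair: "entropy (\<lambda>x. (?f S x, ?f T x)) = entropy (?f (S \<union> T))" for S T
    by (rule entropy_cong) (auto simp: restr_eq_iff)
  have triple: "entropy (\<lambda>x. (?f S x, ?f T x, ?f U x)) = entropy (?f (S \<union> (T \<union> U)))" for S T U
    by (rule entropy_cong) (auto simp: restr_eq_iff)
  from zhang_yeung [of "?f C" "?f D" "?f A" "?f B"]
  have "2 * (entropy (?f C) + entropy (?f D) - entropy (?f (C \<union> D)))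
    \<le> (entropy (?f A) + entropy (?f B) - entropy (?f (A \<union> B)))
     + (entropy (?f A) + entropy (?f (C \<union> D)) - entropy (?f (A \<union> C \<union> D)))
     + 3 * (entropy (?f (A \<union> C)) + entropy (?f (A \<union> D)) - entropy (?f (A \<union> C \<union> D)) - entropy (?f A))
     + (entropy (?f (B \<union> C)) + entropy (?f (B \<union> D)) - entropy (?f (B \<union> C \<union> D)) - entropy (?f B))"
    unfolding pair triple Un_assoc .
  moreover have "entropy (?f S) = real t * rate S" for S
    using t by (simp add: rate_def)
  ultimately have "real t * (2 * (rate C + rate D - rate (C \<union> D)))
    \<le> real t * ((rate A + rate B - rate (A \<union> B)) + (rate A + rate (C \<union> D) - rate (A \<union> C \<union> D))
     + 3 * (rate (A \<union> C) + rate (A \<union> D) - rate (A \<union> C \<union> D) - rate A)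
     + (rate (B \<union> C) + rate (B \<union> D) - rate (B \<union> C \<union> D) - rate B))"
    by (simp add: algebra_simps)
  then show ?thesis
    using t by simp
qed

end

theorem lp_value_2_le_broadcast_rate:
  assumes "bsi_wf G"
  shows "lp_value G 2 \<le> broadcast_rate G"
proof (rule broadcast_rate_ge)
  fix t P E assume "is_solution G t P E" "1 \<le> t"
  with assms interpret index_code G t P E by unfold_locales
  show "lp_value G 2 \<le> log 2 (real (card P)) / real t"
    using lp_value_le [OF rate_feasible] rate_empty by simp
qed

subsection \<open>The directed triangle\<close>

definition directed_triangle :: bsi where
  "directed_triangle = \<lparr>nmsg = 3, nrec = 3, want = (\<lambda>j. j), know = (\<lambda>j. {(j + 1) mod 3})\<rparr>"

lemma Vset_directed_triangle: "Vset directed_triangle = {0, 1, 2}"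
  by (auto simp: Vset_def directed_triangle_def)

lemma wf_directed_triangle: "bsi_wf directed_triangle"
  unfolding bsi_wf_def
proof (intro allI impI)
  fix j assume "j < nrec directed_triangle"
  then have "j = 0 \<or> j = 1 \<or> j = 2"
    by (auto simp: directed_triangle_def)
  then show "want directed_triangle j \<in> Vset directed_triangle \<and>
      know directed_triangle j \<subseteq> Vset directed_triangle - {want directed_triangle j}"
    by (elim disjE) (simp_all add: Vset_directed_triangle, simp_all add: directed_triangle_def)
qed

text \<open>Each pair is decoded from one of its singletons, a different one for each pair. In the
  third-order constraint for the whole triangle the pairs are thus outweighed by the singletons,
  leaving X V <= X {}.\<close>

lemma lp_value_directed_triangle: "3 \<le> lp_value directed_triangle 3"
proof (rule lp_value_ge)
  fix X assume X: "lp_feasible directed_triangle 3 X"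
  have *: "X (insert j S) \<le> X S"
    if "j < 3" "(j + 1) mod 3 \<in> S" "S \<subseteq> {0, 1, 2}" for j S
    using lp_feasible_receiver [OF X wf_directed_triangle, of j S] that Vset_directed_triangle
    by (simp add: directed_triangle_def)
  have "X {0, 1} \<le> X {1}" "X {1, 2} \<le> X {2}" "X {0, 2} \<le> X {0}"
    using * [of 0 "{1}"] * [of 1 "{2}"] * [of 2 "{0}"] by (simp_all add: insert_commute)
  moreover have "X {0, 1, 2} \<le> X {1, 2}" "X {0, 1, 2} \<le> X {0, 2}" "X {0, 1, 2} \<le> X {0, 1}"
    using * [of 0 "{1, 2}"] * [of 1 "{0, 2}"] * [of 2 "{0, 1}"] by (simp_all add: insert_commute)
  moreover have "X {0, 1} \<le> X {0, 1, 2}" "X {0, 2} \<le> X {0, 1, 2}" "X {1, 2} \<le> X {0, 1, 2}"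
    by (intro lp_feasible_mono [OF X]; simp add: Vset_directed_triangle)+
  moreover have "alternating_sum {0, 1, 2} X {} \<le> 0"
    by (intro lp_feasible_alternating [OF X]) (simp_all add: Vset_directed_triangle)
  moreover have "alternating_sum {0, 1, 2} X {} = X {0, 1, 2} - X {0, 1} - X {0, 2} - X {1, 2}
      + X {0} + X {1} + X {2} - X {}"
    by (simp add: alternating_sum_insert insert_commute)
  moreover have "3 \<le> X {0, 1, 2}"
    using lp_feasible_V [OF X] unfolding Vset_directed_triangle by (simp add: directed_triangle_def)
  ultimately show "3 \<le> X {}"
    by linarith
qed

text \<open>With one-bit messages the server sends x 0 + x 1 and x 1 + x 2 modulo 2. Receiver 2
  knows only x 0 and needs both sums, passing through x 1, which it does not want.\<close>

lemma broadcast_rate_directed_triangle: "broadcast_rate directed_triangle \<le> 2"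
proof -
  define E where "E x = (x 0 + x 1) mod 2 + 2 * ((x 1 + x 2) mod 2)" for x :: "nat \<Rightarrow> nat"
  have "is_solution directed_triangle 1 {0..<4} E"
    unfolding is_solution_iff
  proof (intro conjI allI impI ballI)
    show "E ` msgs (nmsg directed_triangle) 1 \<subseteq> {0..<4}"
    proof (intro image_subsetI)
      fix x show "E x \<in> {0..<4}" by (simp add: E_def)
    qed
    fix j x y
    assume j: "j < nrec directed_triangle"
      and xy: "x \<in> msgs (nmsg directed_triangle) 1" "y \<in> msgs (nmsg directed_triangle) 1"
        "E x = E y \<and> (\<forall>i\<in>know directed_triangle j. x i = y i)"
    have bits: "x i < 2" "y i < 2" if "i < 3" for i
      using xy(1,2) that by (simp_all add: msgs_def directed_triangle_def)
    have digits: "a = c" "b = d" if "a + 2 * b = c + 2 * d" "a < 2" "c < 2" for a b c d :: nat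
      using that by presburger+
    have E: "(x 0 + x 1) mod 2 + 2 * ((x 1 + x 2) mod 2) = (y 0 + y 1) mod 2 + 2 * ((y 1 + y 2) mod 2)"
      using xy(3) by (simp add: E_def)
    have sums: "(x 0 + x 1) mod 2 = (y 0 + y 1) mod 2" "(x 1 + x 2) mod 2 = (y 1 + y 2) mod 2"
      using digits [OF E] by simp_all
    have cancel: "a = b" if "(a + c) mod 2 = (b + c) mod 2" "a < 2" "b < 2" for a b c :: nat
      using that by presburger
    have "j = 0 \<or> j = 1 \<or> j = 2"
      using j by (auto simp: directed_triangle_def)
    then show "x (want directed_triangle j) = y (want directed_triangle j)"
    proof (elim disjE)
      assume "j = 0"
      then have "x 1 = y 1" using xy(3) by (simp add: directed_triangle_def)
      then have "x 0 = y 0"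
        using sums(1) bits [of 0] by (intro cancel [of "x 0" "y 1" "y 0"]) simp_all
      then show ?thesis using \<open>j = 0\<close> by (simp add: directed_triangle_def)
    next
      assume "j = 1"
      then have "x 2 = y 2" using xy(3) by (simp add: directed_triangle_def numeral_2_eq_2)
      then have "x 1 = y 1"
        using sums(2) bits [of 1] by (intro cancel [of "x 1" "y 2" "y 1"]) simp_all
      then show ?thesis using \<open>j = 1\<close> by (simp add: directed_triangle_def)
    next
      assume "j = 2"
      then have "x 0 = y 0" using xy(3) by (simp add: directed_triangle_def)
      then have "x 1 = y 1"
        using sums(1) bits [of 1] by (intro cancel [of "x 1" "y 0" "y 1"]) (simp_all add: add.commute)
      then have "x 2 = y 2"
        using sums(2) bits [of 2] by (intro cancel [of "x 2" "y 1" "y 2"]) (simp_all add: add.commute)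
      then show ?thesis using \<open>j = 2\<close> by (simp add: directed_triangle_def)
    qed
  qed simp
  from broadcast_rate_le [OF this] have "broadcast_rate directed_triangle \<le> \<lceil>log 2 (real 4)\<rceil>"
    by simp
  moreover have "log 2 (real 4) = 2"
    using log_nat_power [of 2 2 2] by simp
  ultimately show ?thesis by simp
qed

subsection \<open>The Vamos matroid\<close>

text \<open>The Vamos matroid on the pairs \<open>A = {0, 1}\<close>, \<open>B = {2, 3}\<close>, \<open>C = {4, 5}\<close>, \<open>D = {6, 7}\<close>: every union
  of two pairs except \<open>A \<union> B\<close> is a circuit. Each receiver reads off a message from a circuit or from a
  basis, and the receivers listed suffice to force the values of all joint entropies that occur in the
  Zhang--Yeung inequality, which the matroid rank violates.\<close>

definition vamos_circuits :: "nat set set" where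
  "vamos_circuits = {{0, 1, 4, 5}, {0, 1, 6, 7}, {2, 3, 4, 5}, {2, 3, 6, 7}, {4, 5, 6, 7}}"

definition vamos_rank :: "nat set \<Rightarrow> nat" where
  "vamos_rank S = (if S \<in> vamos_circuits then 3 else min (card S) 4)"

definition vamos_receivers :: "(nat \<times> nat set) list" where
  "vamos_receivers =
    [(7, {4, 5, 6}), (5, {0, 1, 4}), (7, {0, 1, 6}), (5, {2, 3, 4}), (7, {2, 3, 6}),
     (4, {0, 1, 2, 3}), (5, {0, 1, 2, 3}), (6, {0, 1, 2, 3}), (7, {0, 1, 2, 3}),
     (1, {0, 4, 5, 6}), (2, {0, 4, 5, 6}), (3, {0, 4, 5, 6}), (7, {0, 4, 5, 6}),
     (0, {2, 4, 6, 7}), (1, {2, 4, 6, 7}), (3, {2, 4, 6, 7}), (5, {2, 4, 6, 7})]"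

definition vamos :: bsi where
  "vamos = \<lparr>nmsg = 8, nrec = length vamos_receivers,
     want = (\<lambda>j. fst (vamos_receivers ! j)), know = (\<lambda>j. snd (vamos_receivers ! j))\<rparr>"

lemma Vset_vamos: "Vset vamos = {0, 1, 2, 3, 4, 5, 6, 7}"
  by (auto simp: Vset_def vamos_def)

lemma vamos_receiver:
  "j < nrec vamos \<Longrightarrow> (want vamos j, know vamos j) \<in> set vamos_receivers"
  by (simp add: vamos_def)

lemma ex_vamos_receiver:
  assumes "(w, K) \<in> set vamos_receivers"
  obtains j where "j < nrec vamos" "want vamos j = w" "know vamos j = K"
  using assms unfolding in_set_conv_nth by (auto simp: vamos_def)

lemma wf_vamos: "bsi_wf vamos"
proof -
  have *: "\<forall>(w, K) \<in> set vamos_receivers. w \<in> Vset vamos \<and> K \<subseteq> Vset vamos - {w}"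
    unfolding Vset_vamos vamos_receivers_def by simp
  show ?thesis
    unfolding bsi_wf_def using bspec [OF * vamos_receiver] by simp
qed

lemma card_vamos_circuit: "S \<in> vamos_circuits \<Longrightarrow> card S = 4"
  by (auto simp: vamos_circuits_def)

lemma vamos_circuits_inter:
  "S \<in> vamos_circuits \<Longrightarrow> T \<in> vamos_circuits \<Longrightarrow> S \<noteq> T \<Longrightarrow> card (S \<inter> T) \<le> 2"
  unfolding vamos_circuits_def by (elim insertE emptyE; simp)

text \<open>The sparse paving condition behind submodularity of \<open>vamos_rank\<close>: two
  different circuits over a common triple would have ranks 3 + 3, against 4 for their union plus 3
  for the triple.\<close>

lemma vamos_circuits_insert:
  assumes "insert x S \<in> vamos_circuits" "insert y S \<in> vamos_circuits" "x \<notin> S" "y \<notin> S"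
  shows "x = y"
proof (rule ccontr)
  assume "x \<noteq> y"
  then have "insert x S \<noteq> insert y S" "insert x S \<inter> insert y S = S"
    using assms by auto
  then have "card S \<le> 2"
    using vamos_circuits_inter [OF assms(1,2)] by simp
  moreover have "finite S" "card (insert x S) = 4"
    using card_vamos_circuit [OF assms(1)] by (auto intro: card_ge_0_finite [of "insert x S", simplified])
  ultimately show False using assms(3) by simp
qed

lemma vamos_rank_insert:
  assumes "finite S" "x \<notin> S"
  shows "vamos_rank S \<le> vamos_rank (insert x S)" "vamos_rank (insert x S) \<le> vamos_rank S + 1"
  using assms card_vamos_circuit [of S] card_vamos_circuit [of "insert x S"]
  by (auto simp: vamos_rank_def)

lemma vamos_rank_submodular:
  assumes "finite S" "x \<notin> S" "y \<notin> S" "x \<noteq> y"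
  shows "vamos_rank (insert x (insert y S)) + vamos_rank S \<le> vamos_rank (insert x S) + vamos_rank (insert y S)"
  using assms card_vamos_circuit [of S] card_vamos_circuit [of "insert x S"] card_vamos_circuit [of "insert y S"]
    card_vamos_circuit [of "insert x (insert y S)"] vamos_circuits_insert [of x S y]
  by (auto simp: vamos_rank_def)

lemma vamos_rank_receivers:
  "\<forall>(w, K) \<in> set vamos_receivers. vamos_rank (insert w K) \<le> vamos_rank K"
  unfolding vamos_receivers_def vamos_rank_def vamos_circuits_def
  by (simp add: set_eq_subset)

text \<open>The shift 4 is 8 messages minus the full rank 4, so that the value at
  \<open>Vset vamos\<close> is exactly \<open>nmsg vamos\<close>.\<close>

lemma lp_feasible_vamos: "lp_feasible vamos 2 (\<lambda>S. 4 + real (vamos_rank S))"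
proof (rule lp_feasible_submodularI [OF wf_vamos])
  have "Vset vamos \<notin> vamos_circuits"
    using card_vamos_circuit [of "Vset vamos"] by (auto simp: vamos_def)
  then show "real (nmsg vamos) \<le> 4 + real (vamos_rank (Vset vamos))"
    by (simp add: vamos_rank_def) (simp add: vamos_def)
next
  fix S x assume *: "S \<subseteq> Vset vamos" "x \<in> Vset vamos - S"
  show "4 + real (vamos_rank S) \<le> 4 + real (vamos_rank (insert x S))"
    "4 + real (vamos_rank (insert x S)) \<le> 4 + real (vamos_rank S) + 1"
    using vamos_rank_insert [of S x] * finite_subset_Vset [OF *(1)] by auto
next
  fix S x y assume *: "S \<subseteq> Vset vamos" "x \<in> Vset vamos - S" "y \<in> Vset vamos - S" "x \<noteq> y"
  show "4 + real (vamos_rank (insert x (insert y S))) + (4 + real (vamos_rank S))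
      \<le> 4 + real (vamos_rank (insert x S)) + (4 + real (vamos_rank (insert y S)))"
    using vamos_rank_submodular [of S x y] * finite_subset_Vset [OF *(1)] by auto
next
  fix j assume "j < nrec vamos"
  then show "4 + real (vamos_rank (insert (want vamos j) (know vamos j))) \<le> 4 + real (vamos_rank (know vamos j))"
    using bspec [OF vamos_rank_receivers vamos_receiver] by simp
qed simp

lemma lp_value_vamos: "lp_value vamos 2 \<le> 4"
  using lp_value_le [OF lp_feasible_vamos] by (simp add: vamos_rank_def vamos_circuits_def)

lemma broadcast_rate_vamos: "45 / 11 \<le> broadcast_rate vamos"
proof (rule broadcast_rate_ge)
  fix t P E assume "is_solution vamos t P E" "1 \<le> t"
  with wf_vamos interpret index_code vamos t P E by unfold_locales
  have dec: "rate (insert w S) = rate S"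
    if wK: "(w, K) \<in> set vamos_receivers" "K \<subseteq> S" "S \<subseteq> Vset vamos" for w K S
  proof -
    obtain j where "j < nrec vamos" "want vamos j = w" "know vamos j = K"
      using ex_vamos_receiver [OF wK(1)] .
    then show ?thesis using wK rate_decodes [of j S] by simp
  qed
  have slope: "rate T \<le> rate S + real (card (T - S))" if "S \<subseteq> T" "T \<subseteq> Vset vamos" for S T
    using lp_feasible_slope [OF rate_feasible that] .
  have V: "rate {0, 1, 2, 3, 4, 5, 6, 7} = 8"
    using rate_Vset unfolding Vset_vamos by (simp add: vamos_def)
  let ?A = "{0, 1} :: nat set" and ?B = "{2, 3} :: nat set" and ?C = "{4, 5} :: nat set" and ?D = "{6, 7} :: nat set"
  have circuit: "rate (insert w K) \<le> rate {} + 3"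
    if wK: "(w, K) \<in> set vamos_receivers" "card K = 3" for w K
  proof -
    obtain j where "j < nrec vamos" "want vamos j = w" "know vamos j = K"
      using ex_vamos_receiver [OF wK(1)] .
    then have "K \<subseteq> Vset vamos" using wf_vamos by (auto simp: bsi_wf_def)
    then show ?thesis
      using dec [OF wK(1) order_refl] slope [of "{}" K] wK(2) by simp
  qed
  have "rate (?C \<union> ?D) \<le> rate {} + 3" "rate (?A \<union> ?C) \<le> rate {} + 3" "rate (?A \<union> ?D) \<le> rate {} + 3"
    "rate (?B \<union> ?C) \<le> rate {} + 3" "rate (?B \<union> ?D) \<le> rate {} + 3"
    using circuit [of 7 "{4, 5, 6}"] circuit [of 5 "{0, 1, 4}"] circuit [of 7 "{0, 1, 6}"]
      circuit [of 5 "{2, 3, 4}"] circuit [of 7 "{2, 3, 6}"]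
    by (simp_all add: vamos_receivers_def insert_commute)
  moreover have AB: "rate (?A \<union> ?B) = 8"
    using dec [of 4 "{0, 1, 2, 3}" "{0, 1, 2, 3}"] dec [of 5 "{0, 1, 2, 3}" "{0, 1, 2, 3, 4}"]
      dec [of 6 "{0, 1, 2, 3}" "{0, 1, 2, 3, 4, 5}"] dec [of 7 "{0, 1, 2, 3}" "{0, 1, 2, 3, 4, 5, 6}"] V
    by (simp add: vamos_receivers_def Vset_vamos insert_commute)
  moreover have C: "rate {0, 4, 5, 6} = 8"
    using dec [of 1 "{0, 4, 5, 6}" "{0, 4, 5, 6}"] dec [of 2 "{0, 4, 5, 6}" "{0, 1, 4, 5, 6}"]
      dec [of 3 "{0, 4, 5, 6}" "{0, 1, 2, 4, 5, 6}"] dec [of 7 "{0, 4, 5, 6}" "{0, 1, 2, 3, 4, 5, 6}"] V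
    by (simp add: vamos_receivers_def Vset_vamos insert_commute)
  moreover have D: "rate {2, 4, 6, 7} = 8"
    using dec [of 0 "{2, 4, 6, 7}" "{2, 4, 6, 7}"] dec [of 1 "{2, 4, 6, 7}" "{0, 2, 4, 6, 7}"]
      dec [of 3 "{2, 4, 6, 7}" "{0, 1, 2, 4, 6, 7}"] dec [of 5 "{2, 4, 6, 7}" "{0, 1, 2, 3, 4, 6, 7}"] V
    by (simp add: vamos_receivers_def Vset_vamos insert_commute)
  moreover have "rate {0, 4, 5, 6} \<le> rate (?A \<union> ?C \<union> ?D)" "rate {2, 4, 6, 7} \<le> rate (?B \<union> ?C \<union> ?D)"
    by (intro rate_mono; auto)+
  moreover have "rate (?A \<union> ?B) \<le> rate ?A + 2"
    using slope [of ?A "?A \<union> ?B"] by (simp add: Vset_vamos)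
  moreover have "rate {0, 4, 5, 6} \<le> rate ?C + 2"
    using slope [of ?C "{0, 4, 5, 6}"] by (simp add: Vset_vamos)
  moreover have "rate {2, 4, 6, 7} \<le> rate ?D + 2"
    using slope [of ?D "{2, 4, 6, 7}"] by (simp add: Vset_vamos)
  \<comment> \<open>With letters for rates, Zhang-Yeung reads 2C + 2D + A + AB + 4ACD + BCD <= 3CD +
    3AC + 3AD + BC + BD. The right side is at most 11 (rate {} + 3). On the left, A, C and D are at
    least 6 and the larger unions at least 8, giving 12 + 12 + 6 + 8 + 32 + 8 = 78. Hence 11 rate {}
    >= 78 - 33 = 45.\<close>
  ultimately have "45 / 11 \<le> rate {}"
    using rate_zhang_yeung [of ?C ?D ?A ?B] by argo
  then show "45 / 11 \<le> log 2 (real (card P)) / real t"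
    using rate_empty(2) by (rule order_trans)
qed

subsection \<open>The Chinese remainder code\<close>

text \<open>Moebius inversion on the subsets of \<open>S\<close>. Pairing \<open>C\<close> with
  \<open>insert x C\<close> moves the base point to \<open>insert x Z\<close>, so the induction must
  leave \<open>Z\<close> arbitrary.\<close>

lemma sum_alternating_sum:
  assumes "finite S"
  shows "(\<Sum>C\<in>Pow S. alternating_sum C Y Z) = Y (S \<union> Z)"
  using assms
proof (induction S arbitrary: Z rule: finite_induct)
  case (insert x S)
  have inj: "inj_on (insert x) (Pow S)"
    using insert.hyps(2) by (auto simp: inj_on_def)
  have disj: "Pow S \<inter> insert x ` Pow S = {}"
    using insert.hyps(2) by auto
  have "(\<Sum>C\<in>Pow (insert x S). alternating_sum C Y Z)
      = (\<Sum>C\<in>Pow S. alternating_sum C Y Z) + (\<Sum>C\<in>Pow S. alternating_sum (insert x C) Y Z)"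
    unfolding Pow_insert using insert.hyps(1) by (simp add: sum.union_disjoint disj sum.reindex [OF inj])
  also have "\<dots> = (\<Sum>C\<in>Pow S. alternating_sum C Y (insert x Z))"
    unfolding sum.distrib [symmetric]
  proof (rule sum.cong)
    fix C assume "C \<in> Pow S"
    then have "finite C" "x \<notin> C"
      using insert.hyps finite_subset by auto
    then show "alternating_sum C Y Z + alternating_sum (insert x C) Y Z = alternating_sum C Y (insert x Z)"
      by (simp add: alternating_sum_insert)
  qed simp
  finally show ?case by (simp add: insert.IH)
qed simp

text \<open>Writing \<open>X S - card S\<close> as \<open>X {}\<close> minus a sum of weights over the nonempty subsets of \<open>S\<close>, the
  constraints of the largest LP say exactly that the weights are nonnegative.\<close>

lemma lp_feasible_cover:
  assumes wf: "bsi_wf G" and X: "lp_feasible G (nmsg G) X"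
  obtains w :: "nat set \<Rightarrow> real"
  where "\<And>C. C \<subseteq> Vset G \<Longrightarrow> 0 \<le> w C"
    and "(\<Sum>C\<in>Pow (Vset G). w C) \<le> X {}"
    and "\<And>j. j < nrec G \<Longrightarrow> 1 \<le> (\<Sum>C | want G j \<in> C \<and> C \<subseteq> insert (want G j) (know G j). w C)"
proof
  define Y where "Y S = X S - real (card S)" for S
  \<comment> \<open>The coefficient at the empty set is the constant term \<open>X {}\<close> of the
    expansion, so it is excluded from the cover.\<close>
  define w where "w C = (if C = {} then 0 else - alternating_sum C Y {})" for C
  have sum_Y: "(\<Sum>C\<in>Pow S. w C) = X {} - Y S" if "finite S" for S
  proof -
    have "(\<Sum>C\<in>Pow S. w C) = (\<Sum>C\<in>Pow S - {{}}. - alternating_sum C Y {})"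
      by (rule sum.mono_neutral_cong_right) (auto simp: w_def that)
    also have "\<dots> = alternating_sum {} Y {} - (\<Sum>C\<in>Pow S. alternating_sum C Y {})"
      using that by (simp add: sum_negf sum.remove [of "Pow S" "{}"])
    finally show ?thesis
      using sum_alternating_sum [OF that, of Y "{}"] by (simp add: Y_def)
  qed
  show "0 \<le> w C" if C: "C \<subseteq> Vset G" for C
  proof -
    have fin: "finite C" using C by (rule finite_subset_Vset)
    consider "C = {}" | v where "C = {v}" | "2 \<le> card C"
      using fin card_1_singletonE [of C] by (metis One_nat_def card_gt_0_iff less_2_cases_iff not_less neq0_conv card_0_eq)
    then show ?thesis
    proof cases
      case (2 v)
      then show ?thesis
        using lp_feasible_slope [OF X, of "{}" "{v}"] C
        by (simp add: w_def Y_def alternating_sum_insert)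
    next
      case 3
      have "alternating_sum C X {} \<le> 0"
        using C 3 card_mono [OF finite_Vset C] by (intro lp_feasible_alternating [OF X]) simp_all
      then have "alternating_sum C Y {} \<le> 0"
        using alternating_sum_card [of C "{}"] fin 3
        unfolding Y_def by (subst alternating_sum_diff) simp
      then show ?thesis by (simp add: w_def)
    qed (simp add: w_def)
  qed
  show "(\<Sum>C\<in>Pow (Vset G). w C) \<le> X {}"
    using lp_feasible_V [OF X] by (simp add: sum_Y) (simp add: Y_def)
  show "1 \<le> (\<Sum>C | want G j \<in> C \<and> C \<subseteq> insert (want G j) (know G j). w C)" if j: "j < nrec G" for j
  proof -
    have know: "know G j \<subseteq> Vset G" "want G j \<notin> know G j" and fin: "finite (know G j)"
      using wf j finite_subset_Vset [of "know G j" G] by (auto simp: bsi_wf_def)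
    \<comment> \<open>The sets usable by receiver \<open>j\<close> are those that become available
      when the wanted message joins \<open>know G j\<close>. The weight sum is thus a difference of
      \<open>Y\<close>, whose \<open>card\<close> part contributes the required 1.\<close>
    have *: "{C. want G j \<in> C \<and> C \<subseteq> insert (want G j) (know G j)}
        = Pow (insert (want G j) (know G j)) - Pow (know G j)"
      using know(2) by auto
    have "(\<Sum>C | want G j \<in> C \<and> C \<subseteq> insert (want G j) (know G j). w C)
        = (\<Sum>C\<in>Pow (insert (want G j) (know G j)). w C) - (\<Sum>C\<in>Pow (know G j). w C)"
      unfolding * using fin by (intro sum_diff) auto
    also have "\<dots> = Y (know G j) - Y (insert (want G j) (know G j))"
      using fin by (simp add: sum_Y)
    finally show ?thesis
      using lp_feasible_receiver [OF X wf j order_refl know(1)] know(2) fin by (simp add: Y_def)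
  qed
qed

text \<open>The moduli are pairwise coprime as in Goedel's beta function, and all of them lie between
  \<open>2 ^ s\<close> and \<open>2 ^ s\<close> times a constant independent of \<open>s\<close>.\<close>

definition modulus :: "nat \<Rightarrow> nat \<Rightarrow> nat \<Rightarrow> nat" where
  "modulus M s m = 1 + Suc m * (2 ^ s * fact M)"

lemma modulus_ge: "2 ^ s \<le> modulus M s m"
proof -
  have "(2::nat) ^ s * 1 \<le> 2 ^ s * (Suc m * fact M)"
    by (rule mult_le_mono2) (use fact_ge_1 [of M, where 'a = nat] in \<open>simp add: trans_le_add1\<close>)
  also have "\<dots> \<le> modulus M s m"
    by (simp add: modulus_def algebra_simps)
  finally show ?thesis by simp
qed

lemma modulus_le:
  assumes "m < M"
  shows "modulus M s m \<le> 2 ^ s * (1 + M * fact M)"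
proof -
  have "1 + Suc m * (2 ^ s * fact M) \<le> 2 ^ s + M * (2 ^ s * fact M)"
    using assms by (intro add_mono mult_le_mono1) simp_all
  then show ?thesis by (simp add: modulus_def algebra_simps)
qed

text \<open>A common divisor divides the combination in which the multiples of \<open>fact M\<close>
  cancel. What remains is m' - m < M, which divides \<open>fact M\<close>; so the divisor also
  divides the leftover 1.\<close>

lemma coprime_modulus:
  assumes "m < M" "m' < M" "m \<noteq> m'"
  shows "coprime (modulus M s m) (modulus M s m')"
  using assms
proof (induction m m' rule: linorder_wlog)
  case (le m m')
  let ?L = "2 ^ s * fact M :: nat"
  show ?case
  proof (rule coprimeI)
    fix d assume d: "d dvd modulus M s m" "d dvd modulus M s m'"
    then have "d dvd Suc m' * modulus M s m - Suc m * modulus M s m'"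
      by (intro dvd_diff_nat dvd_mult)
    also have "Suc m' * modulus M s m - Suc m * modulus M s m' = m' - m"
      by (simp add: modulus_def algebra_simps)
    also have "m' - m dvd fact M"
      using le by (intro dvd_fact) auto
    finally have "d dvd Suc m * ?L" by simp
    then show "is_unit d"
      using d(1) unfolding modulus_def by (simp only: dvd_add_left_iff)
  qed
next
  case (sym a b)
  then show ?case by (simp add: coprime_commute)
qed

text \<open>Each \<open>C\<close> is used about T w C times on messages of s T bits. With
  \<open>T\<close> fixed, letting \<open>s\<close> grow removes the cost of the oversized moduli;
  then letting \<open>T\<close> grow removes the rounding loss, at most 1 for each of the
  \<open>2 ^ nmsg G\<close> sets.\<close>

lemma broadcast_rate_le_cover:
  fixes w :: "nat set \<Rightarrow> real"
  assumes wf: "bsi_wf G"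
    and nonneg: "\<And>C. C \<subseteq> Vset G \<Longrightarrow> 0 \<le> w C"
    and cover: "\<And>j. j < nrec G \<Longrightarrow> 1 \<le> (\<Sum>C | want G j \<in> C \<and> C \<subseteq> insert (want G j) (know G j). w C)"
  shows "broadcast_rate G \<le> (\<Sum>C\<in>Pow (Vset G). w C)"
proof -
  let ?W = "\<Sum>C\<in>Pow (Vset G). w C"
  have step: "broadcast_rate G \<le> (real T * ?W + 2 ^ nmsg G) / real T" if T: "1 \<le> T" for T
  proof -
    define N where "N C = nat \<lceil>real T * w C\<rceil>" for C
    define I where "I = Sigma (Pow (Vset G)) (\<lambda>C. {0..<N C})"
    define M where "M = card I"
    have fin: "finite I" by (simp add: I_def)
    obtain h where h: "bij_betw h I {0..<M}"
      using ex_bij_betw_finite_nat [OF fin] by (auto simp: M_def)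
    have N: "real T * w C \<le> real (N C)" "C \<subseteq> Vset G \<Longrightarrow> real (N C) \<le> real T * w C + 1" for C
      using nonneg [of C] unfolding N_def by (simp add: real_nat_ceiling_ge, simp add: of_nat_nat le_of_int_ceiling)
    have "real M = (\<Sum>C\<in>Pow (Vset G). real (N C))"
      unfolding M_def I_def by (subst card_SigmaI) simp_all
    also have "\<dots> \<le> (\<Sum>C\<in>Pow (Vset G). real T * w C + 1)"
      by (intro sum_mono N(2)) simp
    also have "\<dots> = real T * ?W + 2 ^ nmsg G"
      by (simp add: sum.distrib sum_distrib_left card_Pow)
    finally have M: "real M \<le> real T * ?W + 2 ^ nmsg G" .
    \<comment> \<open>\<open>K\<close> depends on \<open>T\<close> through \<open>M\<close> but not
      on \<open>s\<close>, which is why the limit in \<open>s\<close> has to be taken first.\<close>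
    define K where "K = 1 + M * fact M"
    have K: "0 < K" by (simp add: K_def)
    have bound: "broadcast_rate G \<le> (real M * (real s + log 2 (real K)) + 1) / (real s * real T)"
      if s: "1 \<le> s" for s
    proof -
      define q where "q i = modulus M s (h i)" for i
      define code where "code x = (\<lambda>i\<in>I. (\<Sum>v\<in>fst i. x v) mod q i)" for x :: "nat \<Rightarrow> nat"
      define U where "U = (\<Pi>\<^sub>E i\<in>I. {0..<q i})"
      have q_pos: "0 < q i" for i by (simp add: q_def modulus_def)
      have "finite U" unfolding U_def using fin by (simp add: finite_PiE)
      then obtain e :: "(nat set \<times> nat \<Rightarrow> nat) \<Rightarrow> nat" and k where e: "inj_on e U"
        using finite_imp_inj_to_nat_seg by blast
      have code: "code x \<in> U" for x
        using q_pos by (simp add: code_def U_def)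
      have sol: "is_solution G (s * T) (e ` U) (\<lambda>x. e (code x))"
        unfolding is_solution_iff
      proof (intro conjI allI impI ballI)
        show "finite (e ` U)" using \<open>finite U\<close> by simp
        show "(\<lambda>x. e (code x)) ` msgs (nmsg G) (s * T) \<subseteq> e ` U" using code by auto
        fix j x y
        assume j: "j < nrec G" and x: "x \<in> msgs (nmsg G) (s * T)" and y: "y \<in> msgs (nmsg G) (s * T)"
          and xy: "e (code x) = e (code y) \<and> (\<forall>i\<in>know G j. x i = y i)"
        let ?v = "want G j"
        have v: "?v < nmsg G" and know: "know G j \<subseteq> Vset G"
          using wf j by (auto simp: bsi_wf_def Vset_def)
        have eq: "code x = code y"
          using xy e code by (auto dest: inj_onD)
        define J where "J = {C. ?v \<in> C \<and> C \<subseteq> insert ?v (know G j)}"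
        define A where "A = Sigma J (\<lambda>C. {0..<N C})"
        have J: "J \<subseteq> Pow (Vset G)" using v know by (auto simp: J_def Vset_def)
        then have "finite J" by (rule finite_subset) simp
        have A: "A \<subseteq> I" using J by (auto simp: A_def I_def)
        have "[x ?v = y ?v] (mod q i)" if i: "i \<in> A" for i
        proof -
          have C: "?v \<in> fst i" "fst i \<subseteq> insert ?v (know G j)" "finite (fst i)"
            using i J finite_subset_Vset by (auto simp: A_def J_def)
          have "code x i = code y i" using eq by simp
          then have "[(\<Sum>v\<in>fst i. x v) = (\<Sum>v\<in>fst i. y v)] (mod q i)"
            using i A by (auto simp: code_def cong_def)
          moreover have "(\<Sum>v\<in>fst i - {?v}. x v) = (\<Sum>v\<in>fst i - {?v}. y v)"
            using C xy by (intro sum.cong) auto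
          ultimately have "[x ?v + (\<Sum>v\<in>fst i - {?v}. y v) = y ?v + (\<Sum>v\<in>fst i - {?v}. y v)] (mod q i)"
            using C by (simp add: sum.remove [of "fst i" ?v])
          then show ?thesis by (simp add: cong_add_rcancel_nat)
        qed
        moreover have "coprime (q i) (q i')" if "i \<in> A" "i' \<in> A" "i \<noteq> i'" for i i'
          unfolding q_def using that A bij_betwE [OF h] bij_betw_imp_inj_on [OF h]
          by (intro coprime_modulus) (auto dest: inj_onD)
        ultimately have "[x ?v = y ?v] (mod (\<Prod>i\<in>A. q i))"
          by (intro cong_cong_prod_coprime_nat) auto
        \<comment> \<open>The cover gives the receiver at least \<open>T\<close> residues, each
          modulo at least \<open>2 ^ s\<close>, so their product exceeds every message value and the
          congruence becomes an equality.\<close>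
        moreover have "2 ^ (s * T) \<le> (\<Prod>i\<in>A. q i)"
        proof -
          have "real T * 1 \<le> real T * (\<Sum>C\<in>J. w C)"
            using cover [OF j] unfolding J_def by (intro mult_left_mono) simp_all
          also have "\<dots> \<le> (\<Sum>C\<in>J. real (N C))"
            unfolding sum_distrib_left by (intro sum_mono N(1))
          also have "\<dots> = real (card A)"
            unfolding A_def using \<open>finite J\<close> by (subst card_SigmaI) simp_all
          finally have "T \<le> card A" by simp
          then have "(2::nat) ^ (s * T) \<le> (2 ^ s) ^ card A"
            by (simp flip: power_mult)
          also have "\<dots> = (\<Prod>i\<in>A. 2 ^ s)" by simp
          also have "\<dots> \<le> (\<Prod>i\<in>A. q i)"
            unfolding q_def by (intro prod_mono) (simp add: modulus_ge)
          finally show ?thesis .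
        qed
        ultimately show "x ?v = y ?v"
          using x y v by (intro cong_less_modulus_unique_nat) (auto simp: msgs_def intro: less_le_trans)
      qed
      have "card (e ` U) \<le> (2 ^ s * K) ^ M"
      proof -
        have "card (e ` U) = (\<Prod>i\<in>I. q i)"
          using fin by (simp add: card_image [OF e]) (simp add: U_def card_PiE)
        also have "\<dots> \<le> (\<Prod>i\<in>I. 2 ^ s * K)"
          unfolding q_def K_def using h
          by (intro prod_mono conjI modulus_le) (auto simp: bij_betw_def)
        finally show ?thesis by (simp add: M_def)
      qed
      then have "log 2 (real (card (e ` U))) \<le> log 2 (real ((2 ^ s * K) ^ M))"
        using card_solution_pos [OF sol] by (intro log_mono) (simp_all only: of_nat_0_less_iff of_nat_le_iff)
      also have "\<dots> = real M * (real s + log 2 (real K))"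
        using K by (simp add: log_nat_power log_mult)
      finally have "real_of_int \<lceil>log 2 (real (card (e ` U)))\<rceil> \<le> real M * (real s + log 2 (real K)) + 1"
        by linarith
      then have "\<lceil>log 2 (real (card (e ` U)))\<rceil> / real (s * T)
          \<le> (real M * (real s + log 2 (real K)) + 1) / real (s * T)"
        by (rule divide_right_mono) simp
      with broadcast_rate_le [OF sol] s T show ?thesis by (simp add: Suc_le_eq)
    qed
    have "(\<lambda>s. (real M * (real s + log 2 (real K)) + 1) / (real s * real T)) \<longlonglongrightarrow> real M / real T"
    proof -
      have "(\<lambda>s. real M / real T + (real M * log 2 (real K) + 1) / real T * inverse (real s)) \<longlonglongrightarrow> real M / real T + (real M * log 2 (real K) + 1) / real T * 0"
        by (intro tendsto_intros LIMSEQ_inverse_real_of_nat [THEN LIMSEQ_imp_Suc])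
      moreover have "\<forall>\<^sub>F s in sequentially. real M / real T + (real M * log 2 (real K) + 1) / real T * inverse (real s)
          = (real M * (real s + log 2 (real K)) + 1) / (real s * real T)"
        using eventually_gt_at_top [of 0] by eventually_elim (use T in \<open>simp add: field_simps\<close>)
      ultimately show ?thesis by (simp add: tendsto_cong)
    qed
    then have "broadcast_rate G \<le> real M / real T"
      by (rule LIMSEQ_le_const) (use bound in blast)
    also have "\<dots> \<le> (real T * ?W + 2 ^ nmsg G) / real T"
      by (intro divide_right_mono M) simp
    finally show ?thesis .
  qed
  have "(\<lambda>T. ?W + 2 ^ nmsg G * inverse (real T)) \<longlonglongrightarrow> ?W + 2 ^ nmsg G * 0"
    by (intro tendsto_intros LIMSEQ_inverse_real_of_nat [THEN LIMSEQ_imp_Suc])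
  then have "(\<lambda>T. ?W + 2 ^ nmsg G * inverse (real T)) \<longlonglongrightarrow> ?W"
    by simp
  then show ?thesis
  proof (rule LIMSEQ_le_const, intro exI allI impI)
    fix T :: nat assume "1 \<le> T"
    then show "broadcast_rate G \<le> ?W + 2 ^ nmsg G * inverse (real T)"
      using step [of T] by (simp add: field_simps)
  qed
qed

theorem broadcast_rate_le_lp_value:
  assumes "bsi_wf G"
  shows "broadcast_rate G \<le> lp_value G (nmsg G)"
proof (rule lp_value_ge)
  fix X assume "lp_feasible G (nmsg G) X"
  from lp_feasible_cover [OF assms this]
  obtain w where w: "\<And>C. C \<subseteq> Vset G \<Longrightarrow> 0 \<le> w C" "(\<Sum>C\<in>Pow (Vset G). w C) \<le> X {}"
    "\<And>j. j < nrec G \<Longrightarrow> 1 \<le> (\<Sum>C | want G j \<in> C \<and> C \<subseteq> insert (want G j) (know G j). w C)"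
    by blast
  show "broadcast_rate G \<le> X {}"
    using broadcast_rate_le_cover [OF assms w(1,3)] w(2) by simp
qed

subsection \<open>Graphs\<close>

lemma is_graphD:
  assumes "is_graph G"
  shows "nrec G = nmsg G" and "v < nmsg G \<Longrightarrow> want G v = v"
    and "u \<in> Vset G \<Longrightarrow> v \<in> Vset G \<Longrightarrow> v \<in> know G u \<longleftrightarrow> u \<in> know G v"
  using assms by (simp_all add: is_graph_def)

lemma graph_know:
  assumes "bsi_wf G" "is_graph G" "v \<in> Vset G"
  shows "know G v \<subseteq> Vset G" "v \<notin> know G v"
  using assms by (auto simp: bsi_wf_def is_graph_def Vset_def)

section \<open>The first program and the independence number\<close>

lemma finite_independent_sizes: "finite {card S | S. independent_set G S}"
proof -
  have "{card S | S. independent_set G S} \<subseteq> card ` Pow (Vset G)"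
    by (auto simp: independent_set_def)
  then show ?thesis by (rule finite_subset) simp
qed

lemma card_le_independence_number:
  "independent_set G S \<Longrightarrow> card S \<le> independence_number G"
  unfolding independence_number_def using finite_independent_sizes by (intro Max_ge) auto

lemma independence_number_attained:
  obtains S where "independent_set G S" "card S = independence_number G"
proof -
  have "independent_set G {}" by (simp add: independent_set_def)
  then have "{card S | S. independent_set G S} \<noteq> {}" by blast
  from Max_in [OF finite_independent_sizes this] show ?thesis
    using that unfolding independence_number_def by auto
qed

text \<open>All neighbours of an independent set lie outside it, so revealing the complement lets
  everything be decoded. The slope constraint prices this at \<open>nmsg G\<close> minus the size of
  the set.\<close>

lemma independence_number_le_lp_value:
  assumes "bsi_wf G" "is_graph G"
  shows "real (independence_number G) \<le> lp_value G k"
proof (rule lp_value_ge)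
  fix X assume X: "lp_feasible G k X"
  obtain S where S: "independent_set G S" "card S = independence_number G"
    by (rule independence_number_attained)
  have sub: "S \<subseteq> Vset G" using S(1) by (simp add: independent_set_def)
  have "decodes G (Vset G - S) (Vset G)"
    unfolding decodes_def
  proof (intro conjI ballI)
    fix x assume "x \<in> Vset G - (Vset G - S)"
    then have x: "x \<in> S" "x \<in> Vset G" by auto
    then have "know G x \<subseteq> Vset G - S"
      using graph_know [OF assms x(2)] S(1) by (auto simp: independent_set_def)
    then show "\<exists>j<nrec G. want G j = x \<and> know G j \<subseteq> Vset G - S"
      using x(2) assms(2) by (auto simp: is_graph_def Vset_def)
  qed auto
  then have "X (Vset G) \<le> X (Vset G - S)"
    by (intro lp_feasible_decodes [OF X]) auto
  moreover have "X (Vset G - S) \<le> X {} + real (card (Vset G - S))"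
    using lp_feasible_slope [OF X, of "{}" "Vset G - S"] by auto
  moreover have "card (Vset G - S) = nmsg G - card S" "card S \<le> nmsg G"
    using sub card_mono [OF finite_Vset sub] by (simp_all add: card_Diff_subset finite_subset_Vset)
  ultimately show "real (independence_number G) \<le> X {}"
    using lp_feasible_V [OF X] S(2) by (simp add: of_nat_diff)
qed

text \<open>Successive decoding, generated backwards from the full set, so that induction peels off
  the first decoding made from \<open>S\<close>.\<close>

inductive reaches :: "bsi \<Rightarrow> nat set \<Rightarrow> bool" for G where
  all: "reaches G (Vset G)"
| decode: "j < nrec G \<Longrightarrow> know G j \<subseteq> S \<Longrightarrow> reaches G (insert (want G j) S) \<Longrightarrow> reaches G S"

lemma reaches_mono: "reaches G S \<Longrightarrow> S \<subseteq> T \<Longrightarrow> T \<subseteq> Vset G \<Longrightarrow> bsi_wf G \<Longrightarrow> reaches G T"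
proof (induction arbitrary: T rule: reaches.induct)
  case all
  then have "T = Vset G" by simp
  then show ?case by (simp add: reaches.all)
next
  case (decode j S)
  have *: "reaches G (insert (want G j) T)"
    using decode.prems decode.hyps(1) by (intro decode.IH) (auto simp: bsi_wf_def)
  show ?case
    by (rule reaches.decode [OF decode.hyps(1) _ *]) (use decode.prems(1) decode.hyps(2) in blast)
qed

text \<open>The first vertex decoded has all its neighbours in \<open>S\<close>; by symmetry no
  vertex still missing is adjacent to it, and the rest is independent by induction.\<close>

lemma reaches_independent:
  assumes "reaches G S" "bsi_wf G" "is_graph G"
  shows "independent_set G (Vset G - S)"
  using assms(1)
proof induction
  case all
  then show ?case by (simp add: independent_set_def)
next
  case (decode j S)
  have j: "j \<in> Vset G" "want G j = j"
    using decode(1) assms(3) by (auto simp: is_graph_def Vset_def)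
  have "v \<notin> know G u" if uv: "u \<in> Vset G - S" "v \<in> Vset G - S" for u v
  proof -
    consider "u = j" | "v = j" | "u \<noteq> j" "v \<noteq> j" by blast
    then show ?thesis
    proof cases
      case 1
      then show ?thesis using uv(2) decode.hyps(2) by blast
    next
      case 2
      then have "u \<notin> know G v" using uv(1) decode.hyps(2) by blast
      then show ?thesis using is_graphD(3) [OF assms(3), of u v] uv by blast
    next
      case 3
      then show ?thesis using uv decode.IH unfolding independent_set_def j(2) by blast
    qed
  qed
  then show ?case by (auto simp: independent_set_def)
qed

text \<open>The number of messages still to be revealed before decoding finishes;
  \<open>nmsg G\<close> minus this is an optimal point of the first program for graphs. Revealing
  everything always works, so the \<open>LEAST\<close> is attained for \<open>S\<close> inside
  \<open>Vset G\<close>.\<close>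

definition completion_cost :: "bsi \<Rightarrow> nat set \<Rightarrow> nat" where
  "completion_cost G S = (LEAST k. \<exists>P\<subseteq>Vset G. card P = k \<and> reaches G (S \<union> P))"

lemma completion_cost_le:
  "P \<subseteq> Vset G \<Longrightarrow> reaches G (S \<union> P) \<Longrightarrow> completion_cost G S \<le> card P"
  unfolding completion_cost_def by (intro Least_le exI [of _ P]) simp

lemma completion_cost_attained:
  assumes "S \<subseteq> Vset G"
  obtains P where "P \<subseteq> Vset G" "card P = completion_cost G S" "reaches G (S \<union> P)"
proof -
  have "\<exists>P\<subseteq>Vset G. card P = nmsg G \<and> reaches G (S \<union> P)"
    using assms by (intro exI [of _ "Vset G"]) (simp add: Un_absorb1 reaches.all)
  then have "\<exists>P\<subseteq>Vset G. card P = completion_cost G S \<and> reaches G (S \<union> P)"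
    unfolding completion_cost_def by (rule LeastI)
  then show ?thesis using that by auto
qed

lemma lp_feasible_completion_cost:
  assumes wf: "bsi_wf G"
  shows "lp_feasible G 1 (\<lambda>S. real (nmsg G) - real (completion_cost G S))"
proof (rule lp_feasibleI [OF wf])
  have "completion_cost G (Vset G) \<le> card ({} :: nat set)"
    by (rule completion_cost_le) (simp_all add: reaches.all)
  then show "real (nmsg G) \<le> real (nmsg G) - real (completion_cost G (Vset G))" by simp
  have "completion_cost G {} \<le> card (Vset G)"
    by (rule completion_cost_le) (simp_all add: reaches.all)
  then show "0 \<le> real (nmsg G) - real (completion_cost G {})" by simp
next
  fix S x assume S: "S \<subseteq> Vset G" "x \<in> Vset G - S"
  obtain P where P: "P \<subseteq> Vset G" "card P = completion_cost G S" "reaches G (S \<union> P)"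
    using completion_cost_attained [OF S(1)] .
  have "reaches G (insert x S \<union> P)"
    using P S by (intro reaches_mono [OF P(3) _ _ wf]) auto
  then show "real (nmsg G) - real (completion_cost G S) \<le> real (nmsg G) - real (completion_cost G (insert x S))"
    using completion_cost_le [OF P(1)] P(2) by simp
  obtain Q where Q: "Q \<subseteq> Vset G" "card Q = completion_cost G (insert x S)" "reaches G (insert x S \<union> Q)"
    using completion_cost_attained [of "insert x S" G] S by auto
  then have "completion_cost G S \<le> card (insert x Q)"
    using S by (intro completion_cost_le) auto
  also have "\<dots> \<le> Suc (card Q)" by (rule card_insert_le_m1) simp_all
  finally show "real (nmsg G) - real (completion_cost G (insert x S))
      \<le> real (nmsg G) - real (completion_cost G S) + 1"
    using Q(2) by simp
next
  fix j S assume j: "j < nrec G" "know G j \<subseteq> S" "S \<subseteq> Vset G"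
  then have "insert (want G j) S \<subseteq> Vset G" using wf by (auto simp: bsi_wf_def)
  then obtain P where P: "P \<subseteq> Vset G" "card P = completion_cost G (insert (want G j) S)"
    "reaches G (insert (want G j) S \<union> P)"
    by (rule completion_cost_attained)
  have "reaches G (S \<union> P)"
    by (rule reaches.decode [OF j(1)]) (use P(3) j(2) in auto)
  then show "real (nmsg G) - real (completion_cost G (insert (want G j) S))
      \<le> real (nmsg G) - real (completion_cost G S)"
    using completion_cost_le [OF P(1)] P(2) by simp
\<comment> \<open>At level 1 the alternating constraints are vacuous, since no \<open>R\<close> has
  2 <= card R <= 1.\<close>
qed auto

theorem lp_value_1_graph:
  assumes "bsi_wf G" "is_graph G"
  shows "lp_value G 1 = real (independence_number G)"
proof (rule antisym)
  obtain P where P: "P \<subseteq> Vset G" "card P = completion_cost G {}" "reaches G ({} \<union> P)"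
    using completion_cost_attained [of "{}" G] by auto
  have "card (Vset G - P) \<le> independence_number G"
    using reaches_independent [OF P(3) assms] by (intro card_le_independence_number) simp
  moreover have "card (Vset G - P) = nmsg G - card P" "card P \<le> nmsg G"
    using P(1) card_mono [OF finite_Vset P(1)] by (simp_all add: card_Diff_subset finite_subset_Vset)
  ultimately have "real (nmsg G) - real (completion_cost G {}) \<le> real (independence_number G)"
    using P(2) by simp
  then show "lp_value G 1 \<le> real (independence_number G)"
    using lp_value_le [OF lp_feasible_completion_cost [OF assms(1)]] by simp
qed (rule independence_number_le_lp_value [OF assms])

section \<open>The last program and fractional clique covers\<close>

lemma finite_cliques [simp]: "finite (cliques G)"
  by (rule finite_subset [of _ "Pow (Vset G)"]) (auto simp: cliques_def is_clique_def)

lemma clique_subset: "C \<in> cliques G \<Longrightarrow> C \<subseteq> Vset G"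
  by (simp add: cliques_def is_clique_def)

lemma clique_finite: "C \<in> cliques G \<Longrightarrow> finite C"
  using clique_subset finite_subset_Vset by blast

lemma frac_clique_cover_number_le:
  assumes "frac_clique_cover G w"
  shows "frac_clique_cover_number G \<le> (\<Sum>C\<in>cliques G. w C)"
  unfolding frac_clique_cover_number_def
proof (rule cInf_lower)
  show "bdd_below {(\<Sum>C\<in>cliques G. w C) | w. frac_clique_cover G w}"
  proof (rule bdd_belowI)
    fix s assume "s \<in> {(\<Sum>C\<in>cliques G. w C) | w. frac_clique_cover G w}"
    then obtain w where "s = (\<Sum>C\<in>cliques G. w C)" "\<forall>C\<in>cliques G. 0 \<le> w C"
      unfolding frac_clique_cover_def by blast
    then show "0 \<le> s" by (simp add: sum_nonneg)
  qed
qed (use assms in blast)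

text \<open>A set \<open>C\<close> is only usable by the vertices of \<open>C\<close> adjacent to all of \<open>C\<close>; these form a clique.\<close>

lemma frac_clique_cover_le_lp_value:
  assumes wf: "bsi_wf G" and G: "is_graph G"
  shows "frac_clique_cover_number G \<le> lp_value G (nmsg G)"
proof (rule lp_value_ge)
  fix X assume X: "lp_feasible G (nmsg G) X"
  obtain w where w: "\<And>C. C \<subseteq> Vset G \<Longrightarrow> 0 \<le> w C" "(\<Sum>C\<in>Pow (Vset G). w C) \<le> X {}"
    "\<And>j. j < nrec G \<Longrightarrow> 1 \<le> (\<Sum>C | want G j \<in> C \<and> C \<subseteq> insert (want G j) (know G j). w C)"
    using lp_feasible_cover [OF wf X] by blast
  define core where "core C = {v \<in> C. C \<subseteq> insert v (know G v)}" for C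
  define u where "u K = (\<Sum>C | C \<in> Pow (Vset G) \<and> core C = K. w C)" for K
  have core: "core ` Pow (Vset G) \<subseteq> cliques G"
    by (auto simp: core_def cliques_def is_clique_def)
  have total: "(\<Sum>K\<in>cliques G. u K) = (\<Sum>C\<in>Pow (Vset G). w C)"
    unfolding u_def by (rule sum.group) (use core in auto)
  have "frac_clique_cover G u"
    unfolding frac_clique_cover_def
  proof (intro conjI ballI)
    show "0 \<le> u K" for K
      unfolding u_def by (intro sum_nonneg w(1)) auto
    fix v assume v: "v \<in> Vset G"
    then have want: "v < nrec G" "want G v = v"
      using G by (auto simp: is_graph_def Vset_def)
    let ?A = "{C \<in> Pow (Vset G). v \<in> core C}" and ?T = "{K \<in> cliques G. v \<in> K}"
    have "?A = {C. want G v \<in> C \<and> C \<subseteq> insert (want G v) (know G v)}"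
      unfolding want(2) core_def using v graph_know(1) [OF wf G v] by auto
    then have "1 \<le> (\<Sum>C\<in>?A. w C)"
      using w(3) [OF want(1)] by simp
    also have "\<dots> = (\<Sum>K\<in>?T. \<Sum>C | C \<in> ?A \<and> core C = K. w C)"
      by (rule sum.group [symmetric]) (use core in auto)
    also have "\<dots> = (\<Sum>K\<in>?T. u K)"
      unfolding u_def by (intro sum.cong) auto
    finally show "1 \<le> (\<Sum>K\<in>?T. u K)" .
  qed
  then have "frac_clique_cover_number G \<le> (\<Sum>K\<in>cliques G. u K)"
    by (rule frac_clique_cover_number_le)
  then show "frac_clique_cover_number G \<le> X {}"
    using w(2) total by simp
qed

text \<open>Over-covered vertices \<open>v\<close> are dropped from each clique independently with probability
  \<open>drop_prob v\<close>, which turns the cover into an exact one. \<open>contained C S\<close> is the probability that the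
  thinned clique lies in \<open>S\<close>, and \<open>cover_rate S - card S\<close> is the expected weight of the thinned
  cliques that do not.\<close>

locale clique_cover =
  fixes G :: bsi and w :: "nat set \<Rightarrow> real"
  assumes wf: "bsi_wf G" and graph: "is_graph G" and cover: "frac_clique_cover G w"
begin

definition weight :: "nat \<Rightarrow> real" where
  "weight v = (\<Sum>C\<in>{C \<in> cliques G. v \<in> C}. w C)"

definition drop_prob :: "nat \<Rightarrow> real" where
  "drop_prob v = 1 - 1 / weight v"

definition contained :: "nat set \<Rightarrow> nat set \<Rightarrow> real" where
  "contained C S = (\<Prod>v\<in>C - S. drop_prob v)"

definition cover_rate :: "nat set \<Rightarrow> real" where
  "cover_rate S = real (card S) + (\<Sum>C\<in>cliques G. w C * (1 - contained C S))"

lemma w_nonneg: "C \<in> cliques G \<Longrightarrow> 0 \<le> w C"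
  using cover by (simp add: frac_clique_cover_def)

lemma weight_ge_1: "v \<in> Vset G \<Longrightarrow> 1 \<le> weight v"
  using cover by (simp add: frac_clique_cover_def weight_def)

lemma drop_prob: "v \<in> Vset G \<Longrightarrow> 0 \<le> drop_prob v" "v \<in> Vset G \<Longrightarrow> drop_prob v \<le> 1"
  using weight_ge_1 [of v] by (simp_all add: drop_prob_def)

lemma contained_bounds:
  assumes "C \<in> cliques G"
  shows "0 \<le> contained C S" "contained C S \<le> 1"
proof -
  have *: "0 \<le> drop_prob v \<and> drop_prob v \<le> 1" if "v \<in> C - S" for v
  proof -
    have "v \<in> Vset G" using that clique_subset [OF assms] by blast
    then show ?thesis using drop_prob by blast
  qed
  show "0 \<le> contained C S"
    unfolding contained_def by (rule prod_nonneg) (use * in blast)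
  show "contained C S \<le> 1"
    unfolding contained_def by (rule prod_le_1) (use * in blast)
qed

lemma weighted_contained_bounds:
  assumes "C \<in> cliques G"
  shows "0 \<le> w C * contained C S" "w C * contained C S \<le> w C"
    "0 \<le> w C * (1 - contained C S)" "w C * (1 - contained C S) \<le> w C"
proof -
  show nonneg: "0 \<le> w C * contained C S"
    using w_nonneg [OF assms] contained_bounds(1) [OF assms] by (rule mult_nonneg_nonneg)
  show le: "w C * contained C S \<le> w C"
    using contained_bounds(2) [OF assms] w_nonneg [OF assms] by (rule mult_left_le)
  show "0 \<le> w C * (1 - contained C S)" "w C * (1 - contained C S) \<le> w C"
    using nonneg le by (simp_all add: right_diff_distrib)
qed

lemma contained_insert:
  assumes "finite C" "x \<notin> S"
  shows "contained C S = (if x \<in> C then drop_prob x else 1) * contained C (insert x S)"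
proof (cases "x \<in> C")
  case True
  have "C - insert x S = C - S - {x}" by blast
  moreover have "prod drop_prob (C - S) = drop_prob x * prod drop_prob (C - S - {x})"
    using True assms by (intro prod.remove) simp_all
  ultimately show ?thesis using True by (simp only: contained_def if_True)
next
  case False
  then have "C - insert x S = C - S" by blast
  then show ?thesis using False by (simp only: contained_def if_False mult_1_left)
qed

text \<open>The subtracted quotient is the expected weight of the thinned cliques that contain
  \<open>x\<close> and become contained once \<open>x\<close> is added. Thinning caps it at 1, which
  monotonicity needs; in an over-cover it could be larger. It equals 1 exactly when decoding
  requires it.\<close>

lemma cover_rate_insert:
  assumes "finite S" "x \<in> Vset G - S"
  shows "cover_rate (insert x S)
    = cover_rate S + 1 - (\<Sum>C\<in>{C \<in> cliques G. x \<in> C}. w C * contained C (insert x S)) / weight x"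
proof -
  have "(\<Sum>C\<in>cliques G. w C * (1 - contained C S)) - (\<Sum>C\<in>cliques G. w C * (1 - contained C (insert x S)))
      = (\<Sum>C\<in>cliques G. if x \<in> C then w C * contained C (insert x S) / weight x else 0)"
    unfolding sum_subtractf [symmetric]
  proof (rule sum.cong)
    fix C assume "C \<in> cliques G"
    then have *: "contained C S = (if x \<in> C then drop_prob x else 1) * contained C (insert x S)"
      using assms by (intro contained_insert clique_finite) auto
    show "w C * (1 - contained C S) - w C * (1 - contained C (insert x S))
        = (if x \<in> C then w C * contained C (insert x S) / weight x else 0)"
      unfolding * by (cases "x \<in> C") (simp_all add: drop_prob_def algebra_simps)
  qed simp
  also have "\<dots> = (\<Sum>C\<in>{C \<in> cliques G. x \<in> C}. w C * contained C (insert x S)) / weight x"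
    unfolding sum_divide_distrib by (rule sum.inter_filter [symmetric]) simp
  finally have "(\<Sum>C\<in>cliques G. w C * (1 - contained C S))
      - (\<Sum>C\<in>cliques G. w C * (1 - contained C (insert x S)))
      = (\<Sum>C\<in>{C \<in> cliques G. x \<in> C}. w C * contained C (insert x S)) / weight x" .
  moreover have "real (card (insert x S)) = real (card S) + 1"
    using assms by simp
  ultimately show ?thesis
    unfolding cover_rate_def by linarith
qed

text \<open>\<open>contained C\<close> is a product over vertices, so differences act factor by
  factor: adding \<open>v\<close> in \<open>C\<close> replaces \<open>drop_prob v\<close> by 1, and
  adding a vertex outside \<open>C\<close> changes nothing. No factor is negative, whatever the
  order, so one point serves every \<open>k\<close>.\<close>

lemma alternating_sum_contained:
  assumes "finite C" "finite R" "R \<inter> Z = {}"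
  shows "alternating_sum R (contained C) Z
    = (\<Prod>v\<in>R. if v \<in> C then 1 - drop_prob v else 0) * contained C (R \<union> Z)"
  using assms(2,3)
proof (induction R arbitrary: Z rule: finite_induct)
  case (insert x R)
  have "contained C (R \<union> Z) = (if x \<in> C then drop_prob x else 1) * contained C (insert x (R \<union> Z))"
    using insert by (intro contained_insert assms) auto
  then show ?case
    using insert by (simp add: alternating_sum_insert algebra_simps)
qed simp

lemma alternating_sum_contained_nonneg:
  assumes "C \<in> cliques G" "R \<subseteq> Vset G" "R \<inter> Z = {}"
  shows "0 \<le> alternating_sum R (contained C) Z"
proof -
  have "0 \<le> (\<Prod>v\<in>R. if v \<in> C then 1 - drop_prob v else 0)"
  proof (rule prod_nonneg)
    fix v assume "v \<in> R"
    then show "0 \<le> (if v \<in> C then 1 - drop_prob v else 0)"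
      using drop_prob(2) [of v] assms(2) by auto
  qed
  then show ?thesis
    using alternating_sum_contained [OF clique_finite [OF assms(1)] finite_subset_Vset [OF assms(2)] assms(3)]
      contained_bounds(1) [OF assms(1)] by simp
qed

lemma cover_rate_feasible: "lp_feasible G k cover_rate"
proof (rule lp_feasibleI [OF wf])
  have "contained C (Vset G) = 1" if "C \<in> cliques G" for C
  proof -
    have "C - Vset G = {}" using clique_subset [OF that] by blast
    then show ?thesis by (simp only: contained_def prod.empty)
  qed
  then have "(\<Sum>C\<in>cliques G. w C * (1 - contained C (Vset G))) = 0"
    by (intro sum.neutral) simp
  then show "real (nmsg G) \<le> cover_rate (Vset G)"
    by (simp add: cover_rate_def)
  show "0 \<le> cover_rate {}"
    unfolding cover_rate_def by (intro add_nonneg_nonneg sum_nonneg weighted_contained_bounds) simp_all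
next
  fix S x assume S: "S \<subseteq> Vset G" "x \<in> Vset G - S"
  let ?sum = "\<Sum>C\<in>{C \<in> cliques G. x \<in> C}. w C * contained C (insert x S)"
  have "0 \<le> ?sum"
    by (intro sum_nonneg weighted_contained_bounds) simp
  moreover have "?sum \<le> weight x"
    unfolding weight_def by (intro sum_mono weighted_contained_bounds) simp
  ultimately have "0 \<le> ?sum / weight x" "?sum / weight x \<le> 1"
    using weight_ge_1 [of x] S by simp_all
  then show "cover_rate S \<le> cover_rate (insert x S)" "cover_rate (insert x S) \<le> cover_rate S + 1"
    using cover_rate_insert [OF finite_subset_Vset [OF S(1)] S(2)] by simp_all
next
  fix j S assume j: "j < nrec G" "know G j \<subseteq> S" "S \<subseteq> Vset G" "want G j \<notin> S"
  have v: "want G j = j" "j \<in> Vset G"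
    using j(1) is_graphD(1) [OF graph] is_graphD(2) [OF graph, of j] by (simp_all add: Vset_def)
  have "contained C (insert j S) = 1" if "C \<in> cliques G" "j \<in> C" for C
  proof -
    have "x \<in> insert j S" if "x \<in> C" for x
    proof (cases "x = j")
      case False
      then have "x \<in> know G j"
        using that \<open>j \<in> C\<close> \<open>C \<in> cliques G\<close> by (simp add: cliques_def is_clique_def)
      then show ?thesis using j(2) by (simp add: subsetD)
    qed simp
    then have "C - insert j S = {}" by blast
    then show ?thesis by (simp only: contained_def prod.empty)
  qed
  then have "(\<Sum>C\<in>{C \<in> cliques G. j \<in> C}. w C * contained C (insert j S)) = weight j"
    unfolding weight_def by (intro sum.cong) simp_all
  moreover have "j \<in> Vset G - S" using v j(4) by simp
  ultimately have "cover_rate (insert j S) = cover_rate S"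
    using cover_rate_insert [OF finite_subset_Vset [OF j(3)], of j] weight_ge_1 [OF v(2)] by simp
  then show "cover_rate (insert (want G j) S) \<le> cover_rate S"
    by (simp add: v(1))
next
  fix R Z assume R: "R \<subseteq> Vset G" "2 \<le> card R" "Z \<subseteq> Vset G" "Z \<inter> R = {}"
  have fin: "finite R" "finite Z" "R \<noteq> {}"
    using R finite_subset_Vset [of R G] finite_subset_Vset [of Z G] by auto
  have "alternating_sum R (\<lambda>S. 1 - contained C S) Z \<le> 0" if "C \<in> cliques G" for C
    unfolding alternating_sum_diff alternating_sum_const [OF fin(1,3)]
    using alternating_sum_contained_nonneg [OF that R(1), of Z] R(4) by (simp add: Int_commute)
  then have "(\<Sum>C\<in>cliques G. w C * alternating_sum R (\<lambda>S. 1 - contained C S) Z) \<le> 0"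
    by (intro sum_nonpos mult_nonneg_nonpos w_nonneg)
  moreover have "alternating_sum R (\<lambda>S. real (card S)) Z = 0"
    using fin R by (intro alternating_sum_card) auto
  ultimately show "alternating_sum R cover_rate Z \<le> 0"
    unfolding cover_rate_def [abs_def] alternating_sum_add alternating_sum_sum by linarith
qed

lemma cover_rate_empty: "cover_rate {} \<le> (\<Sum>C\<in>cliques G. w C)"
proof -
  have "(\<Sum>C\<in>cliques G. w C * (1 - contained C {})) \<le> (\<Sum>C\<in>cliques G. w C)"
    by (intro sum_mono weighted_contained_bounds)
  then show ?thesis by (simp add: cover_rate_def)
qed

end

theorem lp_value_graph:
  assumes wf: "bsi_wf G" and G: "is_graph G"
  shows "lp_value G (nmsg G) = frac_clique_cover_number G"
proof (rule antisym)
  show "lp_value G (nmsg G) \<le> frac_clique_cover_number G"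
    unfolding frac_clique_cover_number_def
  proof (rule cInf_greatest)
    have "1 \<le> (\<Sum>C\<in>{C \<in> cliques G. v \<in> C}. 1 :: real)" if "v \<in> Vset G" for v
    proof -
      have "{v} \<in> {C \<in> cliques G. v \<in> C}"
        using that by (simp add: cliques_def is_clique_def)
      then have "0 < card {C \<in> cliques G. v \<in> C}"
        unfolding card_gt_0_iff using finite_cliques by auto
      then show ?thesis by simp
    qed
    then have "frac_clique_cover G (\<lambda>_. 1)"
      unfolding frac_clique_cover_def by simp
    then show "{(\<Sum>C\<in>cliques G. w C) | w. frac_clique_cover G w} \<noteq> {}" by blast
  next
    fix s assume "s \<in> {(\<Sum>C\<in>cliques G. w C) | w. frac_clique_cover G w}"
    then obtain w where w: "frac_clique_cover G w" "s = (\<Sum>C\<in>cliques G. w C)" by auto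
    interpret clique_cover G w
      using wf G w(1) by unfold_locales
    show "lp_value G (nmsg G) \<le> s"
      using order_trans [OF lp_value_le [OF cover_rate_feasible] cover_rate_empty] w(2) by simp
  qed
qed (rule frac_clique_cover_le_lp_value [OF assms])

theorem theorem1:
  shows
  "(\<forall>G. bsi_wf G \<longrightarrow>
      (\<forall>k. 1 \<le> k \<and> k < nmsg G \<longrightarrow>
         (\<forall>X. lp_feasible G (k + 1) X \<longrightarrow> lp_feasible G k X) \<and>
         lp_value G k \<le> lp_value G (k + 1)) \<and>
      lp_value G 2 \<le> broadcast_rate G \<and> broadcast_rate G \<le> lp_value G (nmsg G) \<and>
      (is_graph G \<longrightarrow>
         lp_value G 1 = real (independence_number G) \<and>
         lp_value G (nmsg G) = frac_clique_cover_number G))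
   \<and> (\<exists>G. bsi_wf G \<and> lp_value G 2 < broadcast_rate G)
   \<and> (\<exists>G. bsi_wf G \<and> broadcast_rate G < lp_value G (nmsg G))"
proof (intro conjI allI impI)
  fix G assume wf: "bsi_wf G"
  show "lp_feasible G k X" if "1 \<le> k \<and> k < nmsg G" "lp_feasible G (k + 1) X" for k X
    using that(2) by (rule lp_feasible_antimono) simp
  show "lp_value G k \<le> lp_value G (k + 1)" if "1 \<le> k \<and> k < nmsg G" for k
    by (rule lp_value_mono) simp
  show "lp_value G 2 \<le> broadcast_rate G"
    by (rule lp_value_2_le_broadcast_rate [OF wf])
  show "broadcast_rate G \<le> lp_value G (nmsg G)"
    by (rule broadcast_rate_le_lp_value [OF wf])
  show "lp_value G 1 = real (independence_number G)" if "is_graph G"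
    by (rule lp_value_1_graph [OF wf that])
  show "lp_value G (nmsg G) = frac_clique_cover_number G" if "is_graph G"
    by (rule lp_value_graph [OF wf that])
next
  have "lp_value vamos 2 < broadcast_rate vamos"
    using lp_value_vamos broadcast_rate_vamos by simp
  then show "\<exists>G. bsi_wf G \<and> lp_value G 2 < broadcast_rate G"
    using wf_vamos by blast
  have "broadcast_rate directed_triangle < lp_value directed_triangle (nmsg directed_triangle)"
    using broadcast_rate_directed_triangle lp_value_directed_triangle
    by (simp add: directed_triangle_def)
  then show "\<exists>G. bsi_wf G \<and> broadcast_rate G < lp_value G (nmsg G)"
    using wf_directed_triangle by blast
qed

end
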